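(* Consider the distributed problem $\min_{x\in\mathbb{R}^d} f(x)=\sum_{i=1}^n f_i(x)$ and the q-PDGD algorithm with constant step-size $h$ (both described in the context). Assume: (1) $X^*=\arg\min_{x\in\mathbb{R}^d} f(x)$ is nonempty and convex; let $f^*=\min_x f(x)$; (2) each $f_i:\mathbb{R}^d\to\mathbb{R}$ is continuously differentiable and $\|\nabla f_i(a)-\nabla f_i(b)\|\le L_{f_i}\|a-b\|$ for all $a,b\in\mathbb{R}^d$, with $L_{f_i}>0$; put $L_f=\max_i L_{f_i}$; (3) (Polyak--Łojasiewicz inequality) there is $\nu>0$ with $\frac12\|\nabla f(x)\|^2\ge\nu(f(x)-f^* )$ for all $x\in\mathbb{R}^d$; (4) the communication graph is undirected and connected; (5) the stochastic gradients are $g_i(x_i(k))=\nabla f_i(x_i(k))+\zeta_i(k)$ with $\mathbb{E}[\zeta_i(k)\mid\mathcal{F}_k]=0$ and $\mathbb{E}[\|\zeta_i(k)\|^2\mid\mathcal{F}_k]\le\sigma^2$ for all $i$ and $k$. Let the parameters satisfy $\beta+\kappa_1\le\alpha\le\kappa_2\beta$, $\beta\ge\max\{\kappa_3,\kappa_4,\kappa_5\}$ and $0<h<\min\left\{\frac{\epsilon_1}{\epsilon_2},\frac{\epsilon_3}{\epsilon_4}\right\}$, where the $\kappa$'s and $\epsilon$'s are the explicit constants defined in the context. Then there exists a constant $C_{err}>0$ such that for every agent $i\in\{1,\dots,n\}$, $$\limsup_{k\to\infty}\left(\mathbb{E}\left[\|x_i(k)-\mathcal{P}_{X^*}(\bar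 x(k))\|^2\right]+\mathbb{E}\left[f(\bar x(k))-f^*\right]\right)\le C_{err},$$ where $\bar x(k)=\frac1n\sum_{i=1}^n x_i(k)$.
   Context: **Notation.** $\|\cdot\|$ is the Euclidean norm; $\mathcal{P}_S(x)=\arg\min_{y\in S}\|x-y\|^2$ is the projection onto $S$. **Network.** There are $n$ agents on a weighted undirected graph with symmetric adjacency matrix $(a_{ij})$, $a_{ij}\ge0$, $a_{ii}=0$; $i,j$ are adjacent iff $a_{ij}>0$. $L=(L_{ij})=D-(a_{ij})$ is the weighted Laplacian, $D$ the diagonal matrix of weighted degrees $\sum_j a_{ij}$. $\rho(L)$ is the spectral radius of $L$ and $\rho_2(L)$ its smallest nonzero eigenvalue; $\rho^2(L)=(\rho(L))^2$. **Random quantizer.** Given $[l,u]$ and $b$ bits, let $\Delta=(u-l)/(2^b-1)$ and let $\tau_1=l<\dots<\tau_{2^b}=u$ be equally spaced with spacing $\Delta$. For $x\in[\tau_i,\tau_{i+1})$ and $p=(x-\tau_i)/\Delta$, $Q(x)=\tau_i$ with probability $1-p$ and $Q(x)=\tau_{i+1}$ with probability $p$; $Q$ is applied element-wise to vectors. **Algorithm q-PDGD.** With positive parameters $\alpha,\beta,h$, arbitrary $x_i(0)\in\mathbb{R}^d$, and $v_i(0)=0$, for $k\ge0$ and each agent $i$: $$x_i(k+1)=x_i(k)-h\Big(\alpha\sum_{j=1}^nL_{ij}Q(x_j(k))+\beta v_i(k)+g_i(x_i(k))\Big),$$ $$v_i(k+1)=v_i(k)+h\beta\sum_{j=1}^nL_{ij}Q(x_j(k)),$$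 where at each iteration the same realization $Q(x_j(k))$ is used everywhere, and $g_i(x_i(k))$ is a stochastic gradient. $\mathcal{F}_k$ is the filtration containing the history of all variables generated up to iteration $k$ (so $x_i(k),v_i(k)$ are $\mathcal{F}_k$-measurable). $\mathbb{E}[\cdot]$ is expectation over the randomness of the stochastic gradients and the quantization. **Quantization noise (standing).** $\varepsilon_i(k)=Q(x_i(k))-x_i(k)$ satisfies $\mathbb{E}[\varepsilon_i(k)\mid\mathcal{F}_k]=0$ and $\mathbb{E}[\|\varepsilon_i(k)\|^2\mid\mathcal{F}_k]\le d\Delta^2/4$ for all $i,k$ (properties of the random quantizer $Q$ with levels $\tau_1,\dots,\tau_{2^b}$ for inputs with coordinates in $[l,u]$). **Constants.** - $\kappa_1=\frac{1}{\rho_2(L)}\left(4+\frac32L_f^2\right)$, $\kappa_2>1$ (an arbitrary fixed number), $\kappa_3=\frac{\kappa_1}{\kappa_2-1}$, - $\kappa_4=\frac14\left(3+\left(9+8\kappa_2+\frac{8}{\rho_2(L)}\right)^{1/2}\right)$, - $\kappa_5=2\left(\kappa_2+\frac{1}{\rho_2(L)}\right)L_f^2+2\left(\left(\kappa_2+\frac{1}{\rho_2(L)}\right)^2L_f^4+L_f^2\right)^{1/2}$, - $\epsilon_2=\max\left\{\beta^2\rho(L)+(2\alpha^2+\beta^2)\rho^2(L)+\frac52L_f^2,\ 2\beta^2+\frac12\right\}$, - $\epsilon_3=\frac14-\frac{1}{2\beta}\left(\frac1\beta+\frac{1}{\rho_2(L)}+\frac{\alpha}{\beta}\right)L_f^2$,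 - $\epsilon_4=\frac{1}{\beta^2}\left(1+\frac{3}{2\rho_2(L)}+\frac{3\alpha}{2\beta}\right)L_f^2+\frac{L_f(1+L_f)}{2}$, - $\epsilon_5=\frac{\alpha+\beta}{2\beta}+\frac{1}{2\rho_2(L)}$, - $\epsilon_1=\min\left\{1,\ \frac{\nu}{2n},\ 2\sqrt{\epsilon_2\epsilon_5}\right\}$. *)

theory Defs
  imports "HOL-Probability.Probability"
begin

section \<open>Optimization\<close>

definition gradient :: "('a::real_inner \<Rightarrow> real) \<Rightarrow> 'a \<Rightarrow> 'a" where
  "gradient f x = (THE D. GDERIV f x :> D)"

definition continuously_differentiable :: "('a::real_inner \<Rightarrow> real) \<Rightarrow> bool" where
  "continuously_differentiable f \<longleftrightarrow>
     (\<forall>x. f differentiable (at x)) \<and> continuous_on UNIV (gradient f)"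

definition argmin_set :: "('a \<Rightarrow> real) \<Rightarrow> 'a set" where
  "argmin_set f = {x. is_arg_min f (\<lambda>_. True) x}"

text \<open>The minimum value of \<open>f\<close>; meaningful when \<open>argmin_set f\<close> is nonempty.\<close>

definition min_value :: "('a \<Rightarrow> real) \<Rightarrow> real" where
  "min_value f = (INF x. f x)"


section \<open>Weighted undirected graphs\<close>

definition weighted_adjacency :: "real ^ 'n ^ 'n \<Rightarrow> bool" where
  "weighted_adjacency A \<longleftrightarrow>
     transpose A = A \<and> (\<forall>i j. 0 \<le> A $ i $ j) \<and> (\<forall>i. A $ i $ i = 0)"

definition connected_graph :: "real ^ 'n ^ 'n \<Rightarrow> bool" where
  "connected_graph A \<longleftrightarrow> (\<forall>i j. (i, j) \<in> {(i, j). A $ i $ j > 0}\<^sup>*)"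

definition laplacian :: "real ^ 'n ^ 'n \<Rightarrow> real ^ 'n ^ 'n" where
  "laplacian A = (\<chi> i j. if i = j then \<Sum>k\<in>UNIV. A $ i $ k else 0) - A"

definition eigenvalue :: "'a::field ^ 'n ^ 'n \<Rightarrow> 'a \<Rightarrow> bool" where
  "eigenvalue A c \<longleftrightarrow> (\<exists>v. v \<noteq> 0 \<and> A *v v = c *s v)"

text \<open>The spectral radius of a real matrix ranges over its complex eigenvalues.\<close>

definition spectral_radius :: "real ^ 'n ^ 'n \<Rightarrow> real" where
  "spectral_radius A = Max (cmod ` {c. eigenvalue (\<chi> i j. complex_of_real (A $ i $ j)) c})"

text \<open>A Laplacian of a connected graph has a nonzero eigenvalue iff there are at least two
  vertices; otherwise the following minimum is taken over the empty set and is unspecified.\<close>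

definition min_nonzero_eigenvalue :: "real ^ 'n ^ 'n \<Rightarrow> real" where
  "min_nonzero_eigenvalue A = Min {c. eigenvalue A c \<and> c \<noteq> 0}"


section \<open>Conditional moments\<close>

text \<open>Second moments use \<^const>\<open>nn_cond_exp\<close>, which takes the value \<open>\<infinity>\<close> where
  \<^const>\<open>real_cond_exp\<close> would be \<open>0\<close> by convention. In a probability space a finite bound
  therefore implies square integrability, and the first moment is then the conditional
  expectation proper.\<close>

definition cond_mean_zero :: "'w measure \<Rightarrow> 'w measure \<Rightarrow> ('w \<Rightarrow> real ^ 'd) \<Rightarrow> bool" where
  "cond_mean_zero M G Z \<longleftrightarrow> (\<forall>c. AE \<omega> in M. real_cond_exp M G (\<lambda>\<omega>. Z \<omega> $ c) \<omega> = 0)"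

definition cond_second_moment_le ::
    "'w measure \<Rightarrow> 'w measure \<Rightarrow> ('w \<Rightarrow> real ^ 'd) \<Rightarrow> real \<Rightarrow> bool" where
  "cond_second_moment_le M G Z s \<longleftrightarrow>
     (AE \<omega> in M. nn_cond_exp M G (\<lambda>\<omega>. ennreal ((norm (Z \<omega>))\<^sup>2)) \<omega> \<le> ennreal s)"


section \<open>Random quantizer\<close>

definition quant_step :: "real \<Rightarrow> real \<Rightarrow> nat \<Rightarrow> real" where
  "quant_step l u b = (u - l) / (2 ^ b - 1)"

text \<open>The levels are indexed by \<open>m \<in> {1..2 ^ b}\<close>.\<close>

definition quant_level :: "real \<Rightarrow> real \<Rightarrow> nat \<Rightarrow> nat \<Rightarrow> real" where
  "quant_level l u b m = l + (real m - 1) * quant_step l u b"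

text \<open>\<open>q\<close> is a quantization of the \<open>G\<close>-measurable random vector \<open>x\<close>: conditionally on \<open>G\<close>, each
  coordinate of \<open>x\<close> lying in a quantization cell is rounded to an end point of that cell with the
  prescribed probabilities. The law is prescribed only on the range of the quantizer. No
  independence between the coordinates is required.\<close>

definition random_quantization ::
    "'w measure \<Rightarrow> 'w measure \<Rightarrow> real \<Rightarrow> real \<Rightarrow> nat \<Rightarrow> ('w \<Rightarrow> real ^ 'd) \<Rightarrow> ('w \<Rightarrow> real ^ 'd) \<Rightarrow> bool"
  where
  "random_quantization M G l u b x q \<longleftrightarrow>
     (\<forall>c. \<forall>m\<in>{1..<2 ^ b}. AE \<omega> in M.
        x \<omega> $ c \<in> {quant_level l u b m ..< quant_level l u b (m + 1)} \<longrightarrow>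
        (let p = (x \<omega> $ c - quant_level l u b m) / quant_step l u b in
           real_cond_exp M G (indicator {\<omega> \<in> space M. q \<omega> $ c = quant_level l u b m}) \<omega> = 1 - p \<and>
           real_cond_exp M G (indicator {\<omega> \<in> space M. q \<omega> $ c = quant_level l u b (m + 1)}) \<omega> = p))"


section \<open>The algorithm\<close>

text \<open>\<open>x k i\<close>, \<open>v k i\<close>, \<open>q k i\<close>, \<open>g k i\<close> are the primal and dual iterates, the realization of the
  quantized primal iterate and the stochastic gradient of agent \<open>i\<close> at iteration \<open>k\<close>.\<close>

definition q_pdgd ::
    "'w measure \<Rightarrow> real ^ 'n ^ 'n \<Rightarrow> real \<Rightarrow> real \<Rightarrow> real \<Rightarrow> ('n \<Rightarrow> real ^ 'd) \<Rightarrow>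
     (nat \<Rightarrow> 'n \<Rightarrow> 'w \<Rightarrow> real ^ 'd) \<Rightarrow> (nat \<Rightarrow> 'n \<Rightarrow> 'w \<Rightarrow> real ^ 'd) \<Rightarrow>
     (nat \<Rightarrow> 'n \<Rightarrow> 'w \<Rightarrow> real ^ 'd) \<Rightarrow> (nat \<Rightarrow> 'n \<Rightarrow> 'w \<Rightarrow> real ^ 'd) \<Rightarrow> bool"
  where
  "q_pdgd M L \<alpha> \<beta> h x0 q g x v \<longleftrightarrow>
     (\<forall>i. \<forall>\<omega>\<in>space M.
        x 0 i \<omega> = x0 i \<and> v 0 i \<omega> = 0 \<and>
        (\<forall>k. x (Suc k) i \<omega> = x k i \<omega> -
               h *\<^sub>R (\<alpha> *\<^sub>R (\<Sum>j\<in>UNIV. L $ i $ j *\<^sub>R q k j \<omega>) + \<beta> *\<^sub>R v k i \<omega> + g k i \<omega>) \<and>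
             v (Suc k) i \<omega> = v k i \<omega> + (h * \<beta>) *\<^sub>R (\<Sum>j\<in>UNIV. L $ i $ j *\<^sub>R q k j \<omega>)))"

definition agent_mean :: "('n::finite \<Rightarrow> real ^ 'd) \<Rightarrow> real ^ 'd" where
  "agent_mean y = (1 / real CARD('n)) *\<^sub>R (\<Sum>i\<in>UNIV. y i)"


section \<open>Constants\<close>

text \<open>\<open>r\<close> and \<open>r2\<close> stand for the spectral radius and the smallest nonzero eigenvalue of the
  Laplacian.\<close>

definition kappa1 :: "real \<Rightarrow> real \<Rightarrow> real" where
  "kappa1 r2 Lf = 1 / r2 * (4 + 3 / 2 * Lf\<^sup>2)"

definition kappa3 :: "real \<Rightarrow> real \<Rightarrow> real \<Rightarrow> real" where
  "kappa3 \<kappa>\<^sub>2 r2 Lf = kappa1 r2 Lf / (\<kappa>\<^sub>2 - 1)"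

definition kappa4 :: "real \<Rightarrow> real \<Rightarrow> real" where
  "kappa4 \<kappa>\<^sub>2 r2 = 1 / 4 * (3 + sqrt (9 + 8 * \<kappa>\<^sub>2 + 8 / r2))"

definition kappa5 :: "real \<Rightarrow> real \<Rightarrow> real \<Rightarrow> real" where
  "kappa5 \<kappa>\<^sub>2 r2 Lf =
     2 * (\<kappa>\<^sub>2 + 1 / r2) * Lf\<^sup>2 + 2 * sqrt ((\<kappa>\<^sub>2 + 1 / r2)\<^sup>2 * Lf ^ 4 + Lf\<^sup>2)"

definition eps2 :: "real \<Rightarrow> real \<Rightarrow> real \<Rightarrow> real \<Rightarrow> real" where
  "eps2 \<alpha> \<beta> r Lf =
     max (\<beta>\<^sup>2 * r + (2 * \<alpha>\<^sup>2 + \<beta>\<^sup>2) * r\<^sup>2 + 5 / 2 * Lf\<^sup>2) (2 * \<beta>\<^sup>2 + 1 / 2)"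

definition eps3 :: "real \<Rightarrow> real \<Rightarrow> real \<Rightarrow> real \<Rightarrow> real" where
  "eps3 \<alpha> \<beta> r2 Lf = 1 / 4 - 1 / (2 * \<beta>) * (1 / \<beta> + 1 / r2 + \<alpha> / \<beta>) * Lf\<^sup>2"

definition eps4 :: "real \<Rightarrow> real \<Rightarrow> real \<Rightarrow> real \<Rightarrow> real" where
  "eps4 \<alpha> \<beta> r2 Lf =
     1 / \<beta>\<^sup>2 * (1 + 3 / (2 * r2) + 3 * \<alpha> / (2 * \<beta>)) * Lf\<^sup>2 + Lf * (1 + Lf) / 2"

definition eps5 :: "real \<Rightarrow> real \<Rightarrow> real \<Rightarrow> real" where
  "eps5 \<alpha> \<beta> r2 = (\<alpha> + \<beta>) / (2 * \<beta>) + 1 / (2 * r2)"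

definition eps1 :: "nat \<Rightarrow> real \<Rightarrow> real \<Rightarrow> real \<Rightarrow> real \<Rightarrow> real \<Rightarrow> real \<Rightarrow> real" where
  "eps1 n \<nu> \<alpha> \<beta> r r2 Lf =
     Min {1, \<nu> / (2 * real n), 2 * sqrt (eps2 \<alpha> \<beta> r Lf * eps5 \<alpha> \<beta> r2)}"

end

theory Submission
  imports Defs
begin

text \<open>
  Stack the agents' vectors into one vector \<open>X\<close> and let \<open>e\<close> be its deviation from consensus. Averaging
  over the agents removes the Laplacian terms, so the average follows a perturbed gradient descent
  for \<open>F\<close>; the deviation \<open>e\<close> and the error \<open>u\<close> of the dual variable, measured against the value
  \<open>- \<nabla>f / \<beta>\<close> that would, up to a common shift, hold the agents in consensus, follow a perturbed
  linear primal-dual iteration. The Lyapunov function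

    \<open>|e|\<^sup>2 / 2 + (u, P u) / 2 + \<alpha> / (2 \<beta>) |u|\<^sup>2 + (e, u) + F (mean X) - min F\<close>,

  with \<open>P\<close> the pseudo-inverse of the Laplacian, couples the three errors. The cross term \<open>(e, u)\<close>
  yields damping of \<open>u\<close>, and \<open>P\<close> together with the weight \<open>\<alpha> / \<beta>\<close> is exactly what cancels the
  indefinite terms of first order in \<open>h\<close>. What is left is \<open>- (\<alpha> - \<beta>) (e, L e) - \<beta> |u|\<^sup>2\<close> plus errors
  that Young's inequality absorbs (lemmas \<open>energy_step_eq\<close> and \<open>energy_drift\<close>): the spectral gap
  turns the first term into a multiple of \<open>|e|\<^sup>2\<close>, and the Polyak--Lojasiewicz inequality makes the
  descent step reduce the optimality gap. So without noise the Lyapunov function contracts by a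
  fixed factor (\<open>lyap_next\<close>).

  The noise is treated pathwise. The quadratic part is a nonnegative quadratic form and \<open>F\<close> is
  smooth and bounded below, so shifting the state by a noise vector multiplies the Lyapunov function
  by at most \<open>1 + \<eta>\<close> and adds a multiple of the squared noise, with \<open>\<eta> > 0\<close> at choice
  (\<open>lyap_noise\<close>). A small \<open>\<eta>\<close> keeps a contraction (\<open>lyap_contraction\<close>). Integration gives
  \<open>a (k + 1) \<le> (1 - \<delta>) a k + c\<close> for the expectations \<open>a k\<close>, as the noises have bounded second
  moments; hence \<open>a\<close> is bounded.

  The Lyapunov function dominates both errors in the theorem: the optimality gap is one of its
  summands, \<open>|e|\<^sup>2\<close> is controlled because \<open>\<alpha> > \<beta>\<close>, and the distance of the average to the minimizers
  is controlled by the gap through the quadratic growth that the Polyak--Lojasiewicz inequality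
  implies (\<open>PL_quadratic_growth\<close>).
\<close>

section \<open>Smooth functions with the Polyak--Lojasiewicz inequality\<close>

lemma gradient_eq:
  fixes f :: "'a::real_inner \<Rightarrow> real"
  assumes "GDERIV f x :> D"
  shows "gradient f x = D"
  unfolding gradient_def
proof (rule the_equality[where P = "\<lambda>D. GDERIV f x :> D", OF assms])
  fix D' assume "GDERIV f x :> D'"
  with assms have "(\<lambda>h. h \<bullet> D') = (\<lambda>h. h \<bullet> D)"
    unfolding gderiv_def by (rule has_derivative_unique[rotated])
  then have "h \<bullet> D' = h \<bullet> D" for h by meson
  then show "D' = D" using vector_eq_ldot[of D' D] by blast
qed

lemma GDERIV_gradient:
  fixes f :: "'a::euclidean_space \<Rightarrow> real"
  assumes "f differentiable (at x)"
  shows "GDERIV f x :> gradient f x"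
proof -
  obtain f' where f': "(f has_derivative f') (at x)"
    using assms by (auto simp: differentiable_def)
  have lin: "linear f'" using f' has_derivative_linear by blast
  have "f' = (\<lambda>h. h \<bullet> adjoint f' 1)"
    using adjoint_works[OF lin, of _ 1] by (auto simp: inner_commute)
  then have D: "GDERIV f x :> adjoint f' 1" unfolding gderiv_def using f' by simp
  with gradient_eq[OF D] show ?thesis by simp
qed

locale smooth_fun =
  fixes F :: "'a::euclidean_space \<Rightarrow> real" and G :: "'a \<Rightarrow> 'a" and l :: real
  assumes deriv: "GDERIV F y :> G y"
    and lip: "norm (G y - G z) \<le> l * norm (y - z)"
    and l_pos: "l > 0"
begin

text \<open>Along the segment from \<open>x\<close> to \<open>x + d\<close>, the function minus its claimed quadratic upper bound has
  nonpositive derivative.\<close>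

lemma descent: "F (x + d) \<le> F x + G x \<bullet> d + l / 2 * (norm d)\<^sup>2"
proof -
  define p where "p t = F (x + t *\<^sub>R d) - t * (G x \<bullet> d) - l / 2 * t\<^sup>2 * (norm d)\<^sup>2" for t :: real
  have D: "(p has_real_derivative (G (x + t *\<^sub>R d) \<bullet> d - G x \<bullet> d - l * t * (norm d)\<^sup>2)) (at t)" for t
  proof -
    have 1: "((\<lambda>t. x + t *\<^sub>R d) has_derivative (\<lambda>s. s *\<^sub>R d)) (at t)"
      by (auto intro!: derivative_eq_intros)
    have "((\<lambda>t. F (x + t *\<^sub>R d)) has_derivative (\<lambda>s. (s *\<^sub>R d) \<bullet> G (x + t *\<^sub>R d))) (at t)"
      using has_derivative_compose[OF 1 deriv[unfolded gderiv_def, of "x + t *\<^sub>R d"]] by simp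
    then have "((\<lambda>t. F (x + t *\<^sub>R d)) has_real_derivative (G (x + t *\<^sub>R d) \<bullet> d)) (at t)"
      by (simp add: has_field_derivative_def inner_commute mult_commute_abs)
    then show ?thesis unfolding p_def
      by (auto intro!: derivative_eq_intros)
  qed
  have "p 1 \<le> p 0"
  proof (rule DERIV_nonpos_imp_nonincreasing[of 0 1 p])
    fix t :: real assume t: "0 \<le> t" "t \<le> 1"
    have "(G (x + t *\<^sub>R d) - G x) \<bullet> d \<le> norm (G (x + t *\<^sub>R d) - G x) * norm d"
      by (rule norm_cauchy_schwarz)
    also have "\<dots> \<le> (l * norm (t *\<^sub>R d)) * norm d"
      using lip[of "x + t *\<^sub>R d" x] by (intro mult_right_mono) auto
    also have "\<dots> = l * t * (norm d)\<^sup>2" using t by (simp add: power2_eq_square)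
    finally show "\<exists>y. (p has_real_derivative y) (at t) \<and> y \<le> 0"
      using D[of t] by (intro exI[of _ "G (x + t *\<^sub>R d) \<bullet> d - G x \<bullet> d - l * t * (norm d)\<^sup>2"]) (simp add: inner_diff_left)
  qed auto
  then show ?thesis by (simp add: p_def)
qed

lemma continuous: "continuous_on S F"
  by (intro continuous_at_imp_continuous_on ballI)
    (rule has_derivative_continuous[OF deriv[unfolded gderiv_def]])

lemma gradient_step: "F (y - (1 / l) *\<^sub>R G y) \<le> F y - (norm (G y))\<^sup>2 / (2 * l)"
proof -
  have "G y \<bullet> (- ((1 / l) *\<^sub>R G y)) + l / 2 * (norm (- ((1 / l) *\<^sub>R G y)))\<^sup>2
      = - ((norm (G y))\<^sup>2 / (2 * l))"
    using l_pos by (simp add: dot_square_norm power_divide) (simp add: power2_eq_square field_simps)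
  with descent[of y "- ((1 / l) *\<^sub>R G y)"] show ?thesis by simp
qed

lemma gradient_norm_le:
  assumes "\<And>y. m \<le> F y"
  shows "(norm (G y))\<^sup>2 \<le> 2 * l * (F y - m)"
proof -
  have "(norm (G y))\<^sup>2 / (2 * l) \<le> F y - m"
    using gradient_step[of y] assms[of "y - (1 / l) *\<^sub>R G y"] by linarith
  then show ?thesis using l_pos by (simp add: field_simps)
qed

text \<open>The first-order term of a step \<open>d\<close> is controlled by the gap itself, since the squared gradient is at
  most a multiple of the gap. The price is an arbitrarily small relative increase; this lets a
  perturbation be estimated by its squared norm alone.\<close>

lemma increment_le:
  assumes "\<And>y. m \<le> F y" and "\<eta> > 0"
  shows "F (y + d) - m \<le> (1 + \<eta>) * (F y - m) + (l / (2 * \<eta>) + l / 2) * (norm d)\<^sup>2"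
proof -
  let ?a = "norm (G y)" and ?b = "norm d"
  have sq: "?a * ?b \<le> \<eta> / (2 * l) * ?a\<^sup>2 + l / (2 * \<eta>) * ?b\<^sup>2"
  proof -
    have "0 \<le> (\<eta> * ?a - l * ?b)\<^sup>2 / (2 * l * \<eta>)" using l_pos assms by simp
    also have "\<dots> = \<eta> / (2 * l) * ?a\<^sup>2 + l / (2 * \<eta>) * ?b\<^sup>2 - ?a * ?b"
      using l_pos assms by (simp add: field_simps power2_eq_square)
    finally show ?thesis by simp
  qed
  have "\<eta> / (2 * l) * ?a\<^sup>2 \<le> \<eta> / (2 * l) * (2 * l * (F y - m))"
    using gradient_norm_le[OF assms(1)] l_pos assms by (intro mult_left_mono) auto
  also have "\<dots> = \<eta> * (F y - m)" using l_pos by simp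
  finally have "G y \<bullet> d \<le> \<eta> * (F y - m) + l / (2 * \<eta>) * ?b\<^sup>2"
    using sq norm_cauchy_schwarz[of "G y" d] by linarith
  with descent[of y d] show ?thesis by (simp add: algebra_simps)
qed

text \<open>Gradient descent from \<open>y\<close> shrinks the gap geometrically. Each step is at most proportional to the
  square root of the current gap, so the path has finite length proportional to the square root of
  the initial gap, and it ends in a minimizer.\<close>

lemma PL_quadratic_growth:
  assumes m: "\<And>y. m \<le> F y" and "\<nu> > 0"
    and PL: "\<And>y. 1 / 2 * (norm (G y))\<^sup>2 \<ge> \<nu> * (F y - m)"
  shows "\<exists>C\<ge>0. \<forall>y. \<exists>z. F z = m \<and> (norm (y - z))\<^sup>2 \<le> C * (F y - m)"
proof -
  \<comment> \<open>the contraction factor of the square root of the gap; \<open>max\<close> covers \<open>\<nu> > l\<close>\<close>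
  define q where "q = sqrt (max 0 (1 - \<nu> / l))"
  have q0: "0 \<le> q" and q1: "q < 1" and q2: "1 - \<nu> / l \<le> q\<^sup>2"
    using \<open>\<nu> > 0\<close> l_pos unfolding q_def by (auto simp: max_def)
  define c where "c = sqrt (2 / l) / (1 - q)"
  have "\<exists>z. F z = m \<and> (norm (y - z))\<^sup>2 \<le> c\<^sup>2 * (F y - m)" for y
  proof -
    define s where "s t = ((\<lambda>y. y - (1 / l) *\<^sub>R G y) ^^ t) y" for t
    have s0: "s 0 = y" and sS: "s (Suc t) = s t - (1 / l) *\<^sub>R G (s t)" for t
      by (auto simp: s_def)
    define a where "a t = sqrt (F (s t) - m)" for t
    have a0: "a t \<ge> 0" for t by (simp add: a_def m)
    have aS: "a (Suc t) \<le> q * a t" for t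
    proof -
      have "F (s (Suc t)) - m \<le> F (s t) - m - (norm (G (s t)))\<^sup>2 / (2 * l)"
        using gradient_step[of "s t"] sS by simp
      also have "\<dots> \<le> F (s t) - m - \<nu> * (F (s t) - m) / l"
        using divide_right_mono[OF PL[of "s t"], of l] l_pos by simp
      also have "\<dots> = (1 - \<nu> / l) * (F (s t) - m)"
        by (simp add: algebra_simps diff_divide_distrib)
      also have "\<dots> \<le> q\<^sup>2 * (F (s t) - m)"
        using q2 m[of "s t"] by (intro mult_right_mono) auto
      finally have "a (Suc t) \<le> sqrt (q\<^sup>2 * (F (s t) - m))"
        unfolding a_def by (rule real_sqrt_le_mono)
      then show ?thesis using q0 by (simp add: a_def real_sqrt_mult)
    qed
    have ap: "a t \<le> q ^ t * a 0" for t
    proof (induction t)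
      case (Suc t)
      then show ?case using aS[of t] mult_left_mono[OF Suc q0] by (simp add: mult.assoc)
    qed simp
    have st: "norm (s t - s (Suc t)) \<le> sqrt (2 / l) * a 0 * q ^ t" for t
    proof -
      have "norm (s t - s (Suc t)) = sqrt ((norm (G (s t)))\<^sup>2) / l"
        using l_pos by (simp add: sS)
      also have "\<dots> \<le> sqrt (2 * l * (F (s t) - m)) / l"
        using gradient_norm_le[OF m, of "s t"] l_pos
        by (intro divide_right_mono real_sqrt_le_mono) auto
      also have "\<dots> = sqrt (2 * l * (F (s t) - m)) / sqrt (l\<^sup>2)"
        using l_pos by simp
      also have "\<dots> = sqrt (2 * l * (F (s t) - m) / l\<^sup>2)"
        by (simp only: real_sqrt_divide)
      also have "2 * l * (F (s t) - m) / l\<^sup>2 = 2 / l * (F (s t) - m)"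
        using l_pos by (simp add: power2_eq_square)
      also have "sqrt (2 / l * (F (s t) - m)) = sqrt (2 / l) * a t"
        unfolding a_def by (rule real_sqrt_mult)
      also have "\<dots> \<le> sqrt (2 / l) * (q ^ t * a 0)"
        using ap l_pos by (intro mult_left_mono) auto
      finally show ?thesis by (simp add: mult_ac)
    qed
    have sums: "(\<lambda>t. sqrt (2 / l) * a 0 * q ^ t) sums (c * a 0)"
      using sums_mult[OF geometric_sums[of q], of "sqrt (2 / l) * a 0"] q0 q1
      by (simp add: c_def field_simps)
    have summ: "summable (\<lambda>t. s t - s (Suc t))"
      by (rule summable_comparison_test'[OF sums_summable[OF sums], of 0]) (use st in auto)
    have norm_summ: "summable (\<lambda>t. norm (s t - s (Suc t)))"
      by (rule summable_comparison_test'[OF sums_summable[OF sums], of 0]) (use st in auto)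
    define z where "z = y - (\<Sum>t. s t - s (Suc t))"
    have part: "(\<Sum>t<N. s t - s (Suc t)) = y - s N" for N
      by (induction N) (auto simp: s0)
    have "(\<lambda>N. y - s N) \<longlonglongrightarrow> (\<Sum>t. s t - s (Suc t))"
      using summable_LIMSEQ[OF summ] by (simp add: part)
    from tendsto_diff[OF tendsto_const[of y] this] have lim: "s \<longlonglongrightarrow> z"
      by (simp add: z_def)
    have "isCont F z"
      using continuous[of UNIV] by (simp add: continuous_on_eq_continuous_at)
    then have "(\<lambda>t. F (s t)) \<longlonglongrightarrow> F z"
      using lim by (rule isCont_tendsto_compose)
    moreover have "(\<lambda>t. F (s t)) \<longlonglongrightarrow> m"
    proof -
      have "a \<longlonglongrightarrow> 0"
      proof (rule tendsto_sandwich[of "\<lambda>_. 0" a sequentially "\<lambda>t. q ^ t * a 0"])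
        show "(\<lambda>t. q ^ t * a 0) \<longlonglongrightarrow> 0"
          using q0 q1 by (intro tendsto_mult_left_zero LIMSEQ_realpow_zero)
      qed (use a0 ap in auto)
      from tendsto_power[OF this, of 2] have "(\<lambda>t. F (s t) - m) \<longlonglongrightarrow> 0"
        by (simp add: a_def m)
      then show ?thesis by (simp add: LIM_zero_iff)
    qed
    ultimately have "F z = m" by (rule LIMSEQ_unique)
    moreover have "(norm (y - z))\<^sup>2 \<le> c\<^sup>2 * (F y - m)"
    proof -
      have "norm (y - z) \<le> (\<Sum>t. norm (s t - s (Suc t)))"
        unfolding z_def using summable_norm[OF norm_summ] by simp
      also have "\<dots> \<le> c * a 0"
        using suminf_le[OF st norm_summ sums_summable[OF sums]] sums_unique[OF sums] by simp
      finally have "(norm (y - z))\<^sup>2 \<le> (c * a 0)\<^sup>2" by (intro power_mono) auto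
      then show ?thesis using m[of y] by (simp add: power_mult_distrib a_def s0)
    qed
    ultimately show ?thesis by blast
  qed
  then show ?thesis by (intro exI[of _ "c\<^sup>2"]) auto
qed

end

section \<open>Eigenvalues of symmetric matrices\<close>

text \<open>A minimizer \<open>w\<close> of the Rayleigh quotient on the unit sphere of the invariant subspace is an
  eigenvector: the residual \<open>b = T w - m w\<close> lies in the subspace, and if it were nonzero, moving from
  \<open>w\<close> slightly against it would lower the quotient.\<close>

lemma symmetric_minimal_eigenvector:
  fixes T :: "'a::euclidean_space \<Rightarrow> 'a"
  assumes "linear T" and sym: "\<And>x y. T x \<bullet> y = x \<bullet> T y"
    and "subspace S" and inv: "\<And>x. x \<in> S \<Longrightarrow> T x \<in> S"
    and "z \<in> S" "z \<noteq> 0"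
  obtains w m where "w \<in> S" "w \<noteq> 0" "T w = m *\<^sub>R w" "\<And>x. x \<in> S \<Longrightarrow> m * (norm x)\<^sup>2 \<le> x \<bullet> T x"
proof -
  interpret T: linear T by fact
  let ?K = "sphere 0 1 \<inter> S"
  have "compact ?K" using \<open>subspace S\<close> by (simp add: closed_subspace compact_Int_closed)
  moreover have "(1 / norm z) *\<^sub>R z \<in> ?K"
    using assms by (auto simp: subspace_scale)
  moreover have "continuous_on ?K (\<lambda>x. x \<bullet> T x)"
    by (intro continuous_intros linear_continuous_on) (simp add: \<open>linear T\<close> linear_conv_bounded_linear[symmetric])
  ultimately obtain w where w: "w \<in> ?K" and min: "\<And>y. y \<in> ?K \<Longrightarrow> w \<bullet> T w \<le> y \<bullet> T y"
    using continuous_attains_inf[of ?K "\<lambda>x. x \<bullet> T x"] by blast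
  define m where "m = w \<bullet> T w"
  have wS: "w \<in> S" and nw: "norm w = 1" using w by auto
  have low: "m * (norm x)\<^sup>2 \<le> x \<bullet> T x" if "x \<in> S" for x
  proof (cases "x = 0")
    case False
    have "(1 / norm x) *\<^sub>R x \<in> ?K" using that False \<open>subspace S\<close> by (auto simp: subspace_scale)
    from min[OF this] have "m \<le> (x \<bullet> T x) / (norm x)\<^sup>2"
      by (simp add: m_def T.scale power2_eq_square)
    then show ?thesis using False by (simp add: pos_le_divide_eq)
  qed (simp add: T.zero)
  define b where "b = T w - m *\<^sub>R w"
  have bS: "b \<in> S" using wS inv \<open>subspace S\<close> by (simp add: b_def subspace_diff subspace_scale)
  have quad: "0 \<le> 2 * t * (norm b)\<^sup>2 + t\<^sup>2 * (b \<bullet> T b - m * (norm b)\<^sup>2)" for t :: real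
  proof -
    have "m * (norm (w + t *\<^sub>R b))\<^sup>2 \<le> (w + t *\<^sub>R b) \<bullet> T (w + t *\<^sub>R b)"
      using wS bS \<open>subspace S\<close> by (intro low) (simp add: subspace_add subspace_scale)
    moreover have "(w + t *\<^sub>R b) \<bullet> T (w + t *\<^sub>R b) = m + 2 * t * (b \<bullet> T w) + t\<^sup>2 * (b \<bullet> T b)"
      using sym[of w b]
      by (simp add: T.add T.scale inner_add_left inner_add_right m_def power2_eq_square
          inner_commute[of w "T b"] inner_commute[of "T w" b] algebra_simps)
    moreover have "(norm (w + t *\<^sub>R b))\<^sup>2 = 1 + 2 * t * (b \<bullet> w) + t\<^sup>2 * (norm b)\<^sup>2"
      using nw unfolding power2_norm_eq_inner
      by (simp add: norm_eq_1 inner_add_left inner_add_right power2_eq_square inner_commute[of w b] algebra_simps)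
    moreover have "b \<bullet> T w = (norm b)\<^sup>2 + m * (b \<bullet> w)"
      by (simp add: b_def power2_norm_eq_inner inner_diff_right)
    ultimately show ?thesis by (simp add: algebra_simps)
  qed
  have "b = 0"
  proof (rule ccontr)
    assume "b \<noteq> 0"
    define p where "p = (norm b)\<^sup>2"
    define c where "c = \<bar>b \<bullet> T b - m * (norm b)\<^sup>2\<bar> + 1"
    have "p > 0" "c > 0" using \<open>b \<noteq> 0\<close> by (auto simp: p_def c_def)
    have "0 \<le> 2 * (- (p / c)) * p + (- (p / c))\<^sup>2 * (b \<bullet> T b - m * (norm b)\<^sup>2)"
      using quad[of "- (p / c)"] by (simp add: p_def)
    also have "\<dots> \<le> 2 * (- (p / c)) * p + (- (p / c))\<^sup>2 * c"
      by (intro add_left_mono mult_left_mono) (auto simp: c_def)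
    finally have "0 \<le> 2 * (- (p / c)) * p + (- (p / c))\<^sup>2 * c" .
    moreover have "2 * (- (p / c)) * p + (- (p / c))\<^sup>2 * c = - (p\<^sup>2 / c)" using \<open>c > 0\<close> by (simp add: power2_eq_square field_simps)
    moreover have "p\<^sup>2 / c > 0" using \<open>p > 0\<close> \<open>c > 0\<close> by simp
    ultimately show False by linarith
  qed
  then have "T w = m *\<^sub>R w" by (simp add: b_def)
  moreover have "w \<noteq> 0" using nw by auto
  ultimately show ?thesis using that[of w m] wS low by blast
qed

text \<open>Eigenvectors for distinct eigenvalues are orthogonal, hence independent. Finiteness is what gives
  the \<^const>\<open>Min\<close> and \<^const>\<open>Max\<close> in the spectral constants their meaning.\<close>

lemma finite_real_eigenvalues:
  fixes L :: "real ^ 'n ^ 'n"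
  assumes "transpose L = L"
  shows "finite {c. eigenvalue L c}"
proof -
  let ?E = "{c. eigenvalue L c}"
  define w where "w c = (SOME v. v \<noteq> 0 \<and> L *v v = c *s v)" for c
  have w: "w c \<noteq> 0 \<and> L *v w c = c *s w c" if "c \<in> ?E" for c
    unfolding w_def using that someI_ex[of "\<lambda>v. v \<noteq> 0 \<and> L *v v = c *s v"]
    by (auto simp: eigenvalue_def)
  have orth: "w c \<bullet> w c' = 0" if "c \<in> ?E" "c' \<in> ?E" "c \<noteq> c'" for c c'
  proof -
    have "(L *v w c) \<bullet> w c' = w c \<bullet> (L *v w c')"
      by (metis assms dot_lmul_matrix transpose_matrix_vector)
    then have "c * (w c \<bullet> w c') = c' * (w c \<bullet> w c')"
      using w that by (simp add: scalar_mult_eq_scaleR)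
    then show ?thesis using that by simp
  qed
  have inj: "inj_on w ?E"
    by (rule inj_onI) (metis orth w inner_eq_zero_iff)
  have "pairwise orthogonal (w ` ?E)"
    using orth by (auto simp: pairwise_def orthogonal_def)
  moreover have "0 \<notin> w ` ?E" using w by auto
  ultimately have "independent (w ` ?E)" by (rule pairwise_orthogonal_independent)
  then have "finite (w ` ?E)" by (rule independent_imp_finite)
  then show ?thesis using finite_imageD inj by blast
qed

text \<open>Split a complex eigenvector into real and imaginary part \<open>R\<close>, \<open>I\<close>. Symmetry of the matrix on the
  pair \<open>R\<close>, \<open>I\<close> forces the imaginary part of the eigenvalue to vanish, and then \<open>R\<close> or \<open>I\<close> is a real
  eigenvector.\<close>

lemma complex_eigenvalues_symmetric:
  fixes L :: "real ^ 'n ^ 'n"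
  assumes "transpose L = L"
  shows "{c. eigenvalue (\<chi> i j. complex_of_real (L $ i $ j)) c} = complex_of_real ` {c. eigenvalue L c}"
    (is "?C = _")
proof (intro equalityI subsetI)
  let ?B = "\<chi> i j. complex_of_real (L $ i $ j)"
  fix c assume "c \<in> ?C"
  then obtain z where z: "z \<noteq> 0" "?B *v z = c *s z" by (auto simp: eigenvalue_def)
  define R where "R = (\<chi> i. Re (z $ i))"
  define I where "I = (\<chi> i. Im (z $ i))"
  have comp: "(\<Sum>j\<in>UNIV. complex_of_real (L $ i $ j) * z $ j) = c * z $ i" for i
    using z(2) by (simp add: vec_eq_iff matrix_vector_mult_def)
  have LR: "L *v R = Re c *s R - Im c *s I"
    using arg_cong[OF comp, of Re] by (simp add: vec_eq_iff matrix_vector_mult_def R_def I_def)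
  have LI: "L *v I = Im c *s R + Re c *s I"
    using arg_cong[OF comp, of Im] by (simp add: vec_eq_iff matrix_vector_mult_def R_def I_def)
  have RI: "R \<noteq> 0 \<or> I \<noteq> 0"
    using z(1) by (auto simp: vec_eq_iff R_def I_def complex_eq_iff)
  have "(L *v R) \<bullet> I = R \<bullet> (L *v I)"
    by (metis assms dot_lmul_matrix transpose_matrix_vector)
  then have "Im c * (R \<bullet> R + I \<bullet> I) = 0"
    by (simp add: LR LI scalar_mult_eq_scaleR inner_diff_left inner_add_right algebra_simps)
  moreover have "R \<bullet> R + I \<bullet> I > 0"
    using RI inner_gt_zero_iff[of R] inner_gt_zero_iff[of I] inner_ge_zero[of R] inner_ge_zero[of I] by linarith
  ultimately have "Im c = 0" by simp
  then have "eigenvalue L (Re c)" "c = complex_of_real (Re c)"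
    using RI LR LI by (auto simp: eigenvalue_def complex_eq_iff)
  then show "c \<in> complex_of_real ` {c. eigenvalue L c}" by blast
next
  fix c assume "c \<in> complex_of_real ` {c. eigenvalue L c}"
  then obtain a z where a: "c = complex_of_real a" "z \<noteq> 0" "L *v z = a *s z"
    by (auto simp: eigenvalue_def)
  have "(\<Sum>j\<in>UNIV. L $ i $ j * z $ j) = a * z $ i" for i
    using a(3) by (simp add: vec_eq_iff matrix_vector_mult_def)
  then have "(\<Sum>j\<in>UNIV. complex_of_real (L $ i $ j) * complex_of_real (z $ j)) = complex_of_real a * complex_of_real (z $ i)" for i
    by (metis (mono_tags, lifting) of_real_mult of_real_sum sum.cong)
  then show "c \<in> ?C"
    using a by (auto simp: eigenvalue_def vec_eq_iff matrix_vector_mult_def intro!: exI[of _ "\<chi> i. complex_of_real (z $ i)"])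
qed

lemma eigenvalue_le_spectral_radius:
  fixes L :: "real ^ 'n ^ 'n"
  assumes "transpose L = L" "eigenvalue L c"
  shows "\<bar>c\<bar> \<le> spectral_radius L"
  unfolding spectral_radius_def complex_eigenvalues_symmetric[OF assms(1)]
  using assms finite_real_eigenvalues[OF assms(1)]
  by (intro Max_ge) (auto simp: image_image)

lemma min_nonzero_eigenvalue:
  fixes L :: "real ^ 'n ^ 'n"
  assumes "transpose L = L" "eigenvalue L c" "c \<noteq> 0"
  shows "eigenvalue L (min_nonzero_eigenvalue L)" "min_nonzero_eigenvalue L \<noteq> 0"
    "min_nonzero_eigenvalue L \<le> c"
proof -
  let ?E = "{c. eigenvalue L c \<and> c \<noteq> 0}"
  have fin: "finite ?E" using finite_real_eigenvalues[OF assms(1)] by (rule rev_finite_subset) auto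
  have "min_nonzero_eigenvalue L \<in> ?E"
    unfolding min_nonzero_eigenvalue_def using fin assms by (intro Min_in) auto
  then show "eigenvalue L (min_nonzero_eigenvalue L)" "min_nonzero_eigenvalue L \<noteq> 0" by auto
  show "min_nonzero_eigenvalue L \<le> c"
    unfolding min_nonzero_eigenvalue_def using fin assms by (intro Min_le) auto
qed

section \<open>The graph Laplacian acting on stacked vectors\<close>

text \<open>The Kronecker product of the matrix with the identity on \<open>\<real>\<^sup>d\<close>, acting on the stacked vectors of all
  agents.\<close>

definition lap_op :: "real ^ 'n ^ 'n \<Rightarrow> real ^ 'd ^ 'n \<Rightarrow> real ^ 'd ^ 'n" where
  "lap_op L X = (\<chi> i. \<Sum>j\<in>UNIV. L $ i $ j *\<^sub>R X $ j)"

definition replicated :: "real ^ 'd \<Rightarrow> real ^ 'd ^ 'n" where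
  "replicated y = (\<chi> i. y)"

definition mean :: "real ^ 'd ^ 'n::finite \<Rightarrow> real ^ 'd" where
  "mean X = agent_mean (($) X)"

definition centered :: "real ^ 'd ^ 'n::finite \<Rightarrow> real ^ 'd ^ 'n" where
  "centered X = X - replicated (mean X)"

lemma linear_lap_op: "linear (lap_op L)"
  by (rule linearI) (simp_all add: lap_op_def vec_eq_iff scaleR_add_right sum.distrib scaleR_sum_right mult_ac)

lemma sum_eq_mean: "(\<Sum>i\<in>UNIV. X $ i) = real CARD('n) *\<^sub>R mean X" for X :: "real ^ 'd ^ 'n::finite"
  by (simp add: mean_def agent_mean_def)

lemma linear_mean: "linear mean"
  by (rule linearI) (simp_all add: mean_def agent_mean_def sum.distrib scaleR_add_right flip: scaleR_sum_right)

lemma linear_replicated: "linear replicated"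
  by (rule linearI) (simp_all add: replicated_def vec_eq_iff)

lemma linear_centered: "linear centered"
proof -
  have "linear (\<lambda>X. replicated (mean X))"
    using linear_compose[OF linear_mean linear_replicated] by (simp add: o_def)
  then show ?thesis
    unfolding centered_def[abs_def] by (intro linear_compose_sub linear_ident)
qed

lemma inner_replicated: "X \<bullet> replicated y = real CARD('n) * (mean X \<bullet> y)"
  for X :: "real ^ 'd ^ 'n::finite"
proof -
  have "X \<bullet> replicated y = (\<Sum>i\<in>UNIV. X $ i) \<bullet> y"
    by (simp add: inner_vec_def replicated_def inner_sum_left del: inner_vec_def) (simp add: inner_vec_def[of X] inner_sum_left replicated_def)
  then show ?thesis by (simp add: sum_eq_mean)
qed

lemma mean_replicated [simp]: "mean (replicated y) = y"
  by (simp add: mean_def agent_mean_def replicated_def sum_constant_scaleR del: sum_constant)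

lemma mean_centered [simp]: "mean (centered X) = 0"
  by (simp add: centered_def linear_diff[OF linear_mean])

lemma centered_eq: "mean X = 0 \<Longrightarrow> centered X = X"
  by (simp add: centered_def linear_0[OF linear_replicated])

lemma norm_replicated: "(norm (replicated y :: real ^ 'd ^ 'n::finite))\<^sup>2 = real CARD('n) * (norm y)\<^sup>2"
  by (simp add: power2_norm_eq_inner inner_replicated)

text \<open>Consensus vectors and vectors of mean zero are orthogonal complements.\<close>

lemma norm_centered_decomp:
  "(norm X)\<^sup>2 = (norm (centered X))\<^sup>2 + real CARD('n) * (norm (mean X))\<^sup>2"
  for X :: "real ^ 'd ^ 'n::finite"
proof -
  have "X = centered X + replicated (mean X)" by (simp add: centered_def)
  then have "(norm X)\<^sup>2 = (norm (centered X + replicated (mean X)))\<^sup>2" by simp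
  also have "\<dots> = (norm (centered X))\<^sup>2 + (norm (replicated (mean X) :: real ^ 'd ^ 'n))\<^sup>2"
    using inner_replicated[of "centered X" "mean X"] by (intro norm_add_Pythagorean) (simp add: orthogonal_def)
  finally show ?thesis by (simp add: norm_replicated)
qed

lemma norm_centered_le: "norm (centered X) \<le> norm X"
  by (rule power2_le_imp_le) (use norm_centered_decomp[of X] in auto)

lemma norm_mean_le: "real CARD('n) * (norm (mean X))\<^sup>2 \<le> (norm X)\<^sup>2" for X :: "real ^ 'd ^ 'n::finite"
  using norm_centered_decomp[of X] by simp

lemma inner_centered: "mean Y = 0 \<Longrightarrow> centered X \<bullet> Y = X \<bullet> Y"
  using inner_replicated[of Y "mean X"] by (simp add: centered_def inner_diff_left inner_commute[of _ Y] inner_diff_right)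

lemma eigenvector_lap_op:
  assumes "lap_op L X = m *\<^sub>R X" "X \<noteq> 0"
  shows "eigenvalue L m"
proof -
  obtain i c where ic: "X $ i $ c \<noteq> 0" using assms(2) by (auto simp: vec_eq_iff)
  define v where "v = (\<chi> i. X $ i $ c)"
  have "v \<noteq> 0" using ic by (auto simp: v_def vec_eq_iff)
  moreover have "L *v v = m *s v"
    using assms(1) by (simp add: vec_eq_iff matrix_vector_mult_def v_def lap_op_def)
  ultimately show ?thesis by (auto simp: eigenvalue_def)
qed

locale graph_laplacian =
  fixes A L :: "real ^ 'n::finite ^ 'n"
  assumes adjacency: "weighted_adjacency A"
    and connected: "connected_graph A"
    and two: "CARD('n) \<ge> 2"
    and L_eq: "L = laplacian A"
begin

lemma A_sym: "A $ i $ j = A $ j $ i"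
proof -
  have "transpose A $ j $ i = A $ j $ i" using adjacency by (simp add: weighted_adjacency_def)
  then show ?thesis by (simp add: transpose_def)
qed

lemma A_nonneg: "A $ i $ j \<ge> 0"
  using adjacency by (simp add: weighted_adjacency_def)

lemma L_sym: "transpose L = L"
  by (auto simp: L_eq laplacian_def transpose_def vec_eq_iff A_sym)

lemma lap_op_nth: "lap_op L X $ i = (\<Sum>j\<in>UNIV. A $ i $ j *\<^sub>R (X $ i - X $ j))"
proof -
  have "lap_op L X $ i = (\<Sum>j\<in>UNIV. (if i = j then (\<Sum>k\<in>UNIV. A $ i $ k) *\<^sub>R X $ j else 0) - A $ i $ j *\<^sub>R X $ j)"
    unfolding lap_op_def L_eq laplacian_def
    by (auto intro!: sum.cong simp: scaleR_diff_left)
  then show ?thesis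
    by (simp add: sum_subtractf scaleR_sum_left scaleR_diff_right)
qed

text \<open>Summation by parts over the edges, from which symmetry and nonnegativity can be read off.\<close>

lemma inner_lap_op:
  "Y \<bullet> lap_op L X = (\<Sum>i\<in>UNIV. \<Sum>j\<in>UNIV. A $ i $ j * ((Y $ i - Y $ j) \<bullet> (X $ i - X $ j))) / 2"
proof -
  let ?S = "\<Sum>i\<in>UNIV. \<Sum>j\<in>UNIV. A $ i $ j * (Y $ i \<bullet> (X $ i - X $ j))"
  have 1: "Y \<bullet> lap_op L X = ?S"
    unfolding inner_vec_def[of Y] by (simp only: lap_op_nth inner_sum_right inner_scaleR_right)
  have "?S = (\<Sum>i\<in>UNIV. \<Sum>j\<in>UNIV. A $ j $ i * (Y $ j \<bullet> (X $ j - X $ i)))"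
    by (rule sum.swap)
  also have "\<dots> = (\<Sum>i\<in>UNIV. \<Sum>j\<in>UNIV. A $ i $ j * (- (Y $ j \<bullet> (X $ i - X $ j))))"
    by (intro sum.cong refl) (simp add: A_sym[of _ _] inner_diff_right)
  finally have 2: "?S = \<dots>" .
  have "?S + ?S = (\<Sum>i\<in>UNIV. \<Sum>j\<in>UNIV. A $ i $ j * ((Y $ i - Y $ j) \<bullet> (X $ i - X $ j)))"
    by (subst (2) 2) (simp add: sum.distrib[symmetric] inner_diff_left algebra_simps)
  with 1 show ?thesis by simp
qed

lemma lap_op_sym: "lap_op L X \<bullet> Y = X \<bullet> lap_op L Y"
  by (subst inner_commute) (simp add: inner_lap_op inner_commute)

lemma lap_op_nonneg: "0 \<le> X \<bullet> lap_op L X"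
  unfolding inner_lap_op by (simp add: sum_nonneg A_nonneg)

lemma lap_op_replicated [simp]: "lap_op L (replicated y) = 0"
  by (simp add: vec_eq_iff lap_op_nth) (simp add: replicated_def)

lemma mean_lap_op [simp]: "mean (lap_op L X) = 0"
proof -
  have "real CARD('n) * (mean (lap_op L X) \<bullet> mean (lap_op L X)) = 0"
    using lap_op_sym[of X "replicated (mean (lap_op L X))"]
    by (simp only: inner_replicated[symmetric] lap_op_replicated) simp
  then show ?thesis by simp
qed

lemma lap_op_centered [simp]: "lap_op L (centered X) = lap_op L X"
  by (simp add: centered_def linear_diff[OF linear_lap_op])

text \<open>Vanishing of the edge sum makes the entries agree along every edge, hence everywhere by
  connectedness.\<close>

lemma zero_if_quadratic_form_zero:
  fixes X :: "real ^ 'd ^ 'n"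
  assumes "X \<bullet> lap_op L X = 0" "mean X = 0"
  shows "X = 0"
proof -
  have "(\<Sum>i\<in>UNIV. \<Sum>j\<in>UNIV. A $ i $ j * ((X $ i - X $ j) \<bullet> (X $ i - X $ j))) = 0"
    using assms(1) by (simp add: inner_lap_op)
  then have "A $ i $ j * ((X $ i - X $ j) \<bullet> (X $ i - X $ j)) = 0" for i j
    by (simp add: sum_nonneg_eq_0_iff sum_nonneg A_nonneg del: inner_eq_zero_iff)
  then have edge: "A $ i $ j > 0 \<Longrightarrow> X $ i = X $ j" for i j
    by (metis eq_iff_diff_eq_0 inner_eq_zero_iff less_irrefl mult_eq_0_iff)
  have "X $ i = X $ j" if "(i, j) \<in> {(i, j). A $ i $ j > 0}\<^sup>*" for i j
    using that by (induction rule: rtrancl_induct) (auto dest: edge)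
  then have const: "X $ i = X $ j" for i j using connected by (simp add: connected_graph_def)
  have "X $ j = 0" for j
  proof -
    have "(\<Sum>i\<in>UNIV. X $ i) = (\<Sum>i\<in>(UNIV::'n set). X $ j)" using const by (intro sum.cong) auto
    then show ?thesis using assms(2) by (simp add: sum_eq_mean sum_constant_scaleR del: sum_constant)
  qed
  then show ?thesis by (simp add: vec_eq_iff)
qed

text \<open>Minimizing the Rayleigh quotient over the vectors of mean zero gives an eigenvalue that is nonzero
  by connectedness, so the smallest nonzero eigenvalue lies below it. With at least two agents
  that space is nontrivial.\<close>

lemma spectral_gap:
  "0 < min_nonzero_eigenvalue L" (is ?A)
  "eigenvalue L (min_nonzero_eigenvalue L)"
  "\<And>X :: real ^ 'd::finite ^ 'n. mean X = 0 \<Longrightarrow> min_nonzero_eigenvalue L * (norm X)\<^sup>2 \<le> X \<bullet> lap_op L X" (is "PROP ?B")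
proof -
  let ?S = "{X :: real ^ 'd ^ 'n. mean X = 0}"
  have "\<exists>i j :: 'n. i \<noteq> j"
  proof (rule ccontr)
    assume "\<nexists>i j :: 'n. i \<noteq> j"
    then have "CARD('n) \<le> Suc 0" by (subst card_le_Suc0_iff_eq) auto
    then show False using two by simp
  qed
  then obtain i j :: 'n where "i \<noteq> j" by blast
  define Z :: "real ^ 'd ^ 'n" where "Z = centered (\<chi> k. if k = i then 1 else 0)"
  have "Z $ i - Z $ j = 1" using \<open>i \<noteq> j\<close> by (simp add: Z_def centered_def replicated_def)
  then have "Z \<noteq> 0" by auto
  moreover have "Z \<in> ?S" by (simp add: Z_def)
  moreover have "subspace ?S" using linear_mean by (rule linear_subspace_kernel)
  ultimately obtain w m where w: "w \<in> ?S" "w \<noteq> 0" "lap_op L w = m *\<^sub>R w"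
    and low: "\<And>X. X \<in> ?S \<Longrightarrow> m * (norm X)\<^sup>2 \<le> X \<bullet> lap_op L X"
    using symmetric_minimal_eigenvector[of "lap_op L" ?S Z, OF linear_lap_op lap_op_sym] by auto
  have "m \<noteq> 0" using zero_if_quadratic_form_zero[of w] w by auto
  note m = min_nonzero_eigenvalue[OF L_sym eigenvector_lap_op[OF w(3,2)] this]
  show "eigenvalue L (min_nonzero_eigenvalue L)" by (rule m)
  show "PROP ?B"
  proof -
    fix X :: "real ^ 'd ^ 'n" assume "mean X = 0"
    then have "m * (norm X)\<^sup>2 \<le> X \<bullet> lap_op L X" using low by simp
    moreover have "min_nonzero_eigenvalue L * (norm X)\<^sup>2 \<le> m * (norm X)\<^sup>2"
      using m(3) by (intro mult_right_mono) auto
    ultimately show "min_nonzero_eigenvalue L * (norm X)\<^sup>2 \<le> X \<bullet> lap_op L X" by linarith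
  qed
  obtain v where v: "v \<noteq> 0" "L *v v = min_nonzero_eigenvalue L *s v"
    using m(1) by (auto simp: eigenvalue_def)
  define V :: "real ^ 'd ^ 'n" where "V = (\<chi> k. (v $ k) *\<^sub>R 1)"
  have "lap_op L V = min_nonzero_eigenvalue L *\<^sub>R V"
    using v(2) by (simp add: vec_eq_iff matrix_vector_mult_def lap_op_def V_def)
  then have "0 \<le> min_nonzero_eigenvalue L * (V \<bullet> V)"
    using lap_op_nonneg[of V] by simp
  moreover have "V \<bullet> V > 0" using v(1) by (auto simp: V_def vec_eq_iff)
  ultimately show ?A using m(2) by (simp add: zero_le_mult_iff)
qed

lemma spectral_radius_bound: "X \<bullet> lap_op L X \<le> spectral_radius L * (norm X)\<^sup>2"
  for X :: "real ^ 'd::finite ^ 'n"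
proof -
  define Z :: "real ^ 'd ^ 'n" where "Z = replicated 1"
  have Z: "Z \<noteq> 0" by (simp add: Z_def replicated_def vec_eq_iff)
  have lin: "linear (\<lambda>X :: real ^ 'd ^ 'n. - lap_op L X)" using linear_lap_op by (rule linear_compose_neg)
  have sym: "- lap_op L Y \<bullet> Y' = Y \<bullet> - lap_op L Y'" for Y Y' :: "real ^ 'd ^ 'n"
    by (simp add: lap_op_sym)
  obtain w :: "real ^ 'd ^ 'n" and m where w: "w \<noteq> 0" "- lap_op L w = m *\<^sub>R w"
    and low: "\<And>X :: real ^ 'd ^ 'n. X \<in> UNIV \<Longrightarrow> m * (norm X)\<^sup>2 \<le> X \<bullet> (- lap_op L X)"
    by (rule symmetric_minimal_eigenvector[OF lin sym subspace_UNIV UNIV_I UNIV_I Z]) blast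
  have "lap_op L w = (- m) *\<^sub>R w" using arg_cong[OF w(2), of uminus] by simp
  from eigenvector_lap_op[OF this w(1)] have "eigenvalue L (- m)" .
  from eigenvalue_le_spectral_radius[OF L_sym this] have "- m \<le> spectral_radius L" by simp
  then have "- m * (norm X)\<^sup>2 \<le> spectral_radius L * (norm X)\<^sup>2" by (intro mult_right_mono) auto
  with low[of X] show ?thesis by simp
qed

text \<open>Nonnegativity of the quadratic form at \<open>X - L X / \<rho>\<close> gives \<open>|L X|\<^sup>2 \<le> \<rho> (X, L X)\<close>.\<close>

lemma norm_lap_op_le: "norm (lap_op L X) \<le> spectral_radius L * norm X"
  and spectral_radius_pos: "0 < spectral_radius L"
proof -
  have pos: "0 < spectral_radius L"
    using spectral_gap(1) eigenvalue_le_spectral_radius[OF L_sym spectral_gap(2)] by linarith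
  show "0 < spectral_radius L" by fact
  define s where "s = 1 / spectral_radius L"
  let ?s = s and ?Z = "lap_op L X"
  have "0 \<le> (X - ?s *\<^sub>R ?Z) \<bullet> lap_op L (X - ?s *\<^sub>R ?Z)" by (rule lap_op_nonneg)
  also have "\<dots> = X \<bullet> ?Z - 2 * ?s * (norm ?Z)\<^sup>2 + ?s\<^sup>2 * (?Z \<bullet> lap_op L ?Z)"
    unfolding power2_norm_eq_inner lap_op_sym[of X ?Z]
    by (simp add: linear_diff[OF linear_lap_op] linear_scale[OF linear_lap_op] inner_diff_left inner_diff_right
       lap_op_sym[of X ?Z] power2_eq_square algebra_simps)
  also have "\<dots> \<le> X \<bullet> ?Z - 2 * ?s * (norm ?Z)\<^sup>2 + ?s\<^sup>2 * (spectral_radius L * (norm ?Z)\<^sup>2)"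
    by (intro add_left_mono mult_left_mono spectral_radius_bound) auto
  also have "\<dots> = X \<bullet> ?Z - (norm ?Z)\<^sup>2 / spectral_radius L"
    using pos unfolding s_def by (simp add: power2_eq_square field_simps)
  also have "X \<bullet> ?Z \<le> spectral_radius L * (norm X)\<^sup>2" by (rule spectral_radius_bound)
  finally have "(norm ?Z)\<^sup>2 \<le> (spectral_radius L * norm X)\<^sup>2"
    using pos by (simp add: field_simps power2_eq_square)
  then show "norm (lap_op L X) \<le> spectral_radius L * norm X"
    by (rule power2_le_imp_le) (use pos in auto)
qed

text \<open>Adding the averaging projection to the Laplacian makes it invertible; its inverse, precomposed with
  centering, is the pseudo-inverse.\<close>

lemma pseudo_inverse:
  obtains P :: "real ^ 'd::finite ^ 'n \<Rightarrow> real ^ 'd ^ 'n"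
  where "linear P" "\<And>X. mean (P X) = 0" "\<And>X. lap_op L (P X) = centered X"
    "\<And>X. mean X = 0 \<Longrightarrow> P (lap_op L X) = X"
    "\<And>X Y. P X \<bullet> Y = X \<bullet> P Y" "\<And>X. 0 \<le> X \<bullet> P X"
    "\<And>X. norm (P X) \<le> norm X / min_nonzero_eigenvalue L"
proof -
  define N :: "real ^ 'd ^ 'n \<Rightarrow> real ^ 'd ^ 'n" where "N X = lap_op L X + replicated (mean X)" for X
  have lin: "linear N"
    by (rule linearI)
      (simp_all add: N_def linear_add[OF linear_mean] linear_add[OF linear_replicated]
        linear_add[OF linear_lap_op] linear_scale[OF linear_mean] linear_scale[OF linear_replicated]
        linear_scale[OF linear_lap_op] scaleR_add_right)
  have mean_N: "mean (N X) = mean X" for X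
    by (simp add: N_def linear_add[OF linear_mean])
  have "inj N"
    unfolding linear_injective_0[OF lin]
  proof (intro allI impI)
    fix X assume "N X = 0"
    then have "mean X = 0" using mean_N[of X] by (simp add: linear_0[OF linear_mean])
    with \<open>N X = 0\<close> have "lap_op L X = 0" by (simp add: N_def linear_0[OF linear_replicated])
    with \<open>mean X = 0\<close> show "X = 0" by (intro zero_if_quadratic_form_zero) auto
  qed
  then obtain N' where N': "linear N'" "\<And>X. N' (N X) = X" "\<And>X. N (N' X) = X"
    using linear_injective_isomorphism[OF lin] by metis
  define P where "P X = N' (centered X)" for X
  have P1: "linear P"
    by (rule linearI)
      (simp_all add: P_def linear_add[OF linear_centered] linear_scale[OF linear_centered]
        linear_add[OF N'(1)] linear_scale[OF N'(1)])
  have P2: "mean (P X) = 0" for X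
    using mean_N[of "P X"] by (simp add: P_def N')
  have P3: "lap_op L (P X) = centered X" for X
    using N'(3)[of "centered X"] P2[of X] by (simp add: P_def N_def linear_0[OF linear_replicated])
  have P4: "P (lap_op L X) = X" if "mean X = 0" for X
    using N'(2)[of X] that by (simp add: P_def centered_eq) (simp add: N_def linear_0[OF linear_replicated])
  have P5: "P X \<bullet> Y = X \<bullet> P Y" for X Y
    using inner_centered[OF P2[of X], of Y] inner_centered[OF P2[of Y], of X] lap_op_sym[of "P X" "P Y"]
    by (simp add: P3 inner_commute)
  have P6: "X \<bullet> P X = P X \<bullet> lap_op L (P X)" for X
    using inner_centered[OF P2[of X], of X] by (simp add: P3 inner_commute)
  have P7: "norm (P X) \<le> norm X / min_nonzero_eigenvalue L" for X
  proof (cases "P X = 0")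
    case False
    have "min_nonzero_eigenvalue L * (norm (P X))\<^sup>2 \<le> X \<bullet> P X"
      unfolding P6 by (rule spectral_gap(3)) (rule P2)
    also have "\<dots> \<le> norm X * norm (P X)" by (rule norm_cauchy_schwarz)
    finally have "min_nonzero_eigenvalue L * norm (P X) \<le> norm X"
      using False by (simp add: power2_eq_square)
    then show ?thesis using spectral_gap(1) by (simp add: pos_le_divide_eq mult.commute)
  qed (use spectral_gap(1) in simp)
  have P8: "0 \<le> X \<bullet> P X" for X unfolding P6 by (rule lap_op_nonneg)
  show ?thesis
    by (rule that[of P]) (use P1 P2 P3 P4 P5 P7 P8 in auto)
qed

end

section \<open>The quadratic part of the Lyapunov function\<close>

lemma young:
  fixes x y :: "'a::real_inner"
  assumes "c > 0"
  shows "x \<bullet> y \<le> c / 2 * (norm x)\<^sup>2 + 1 / (2 * c) * (norm y)\<^sup>2"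
proof -
  have "0 \<le> (norm (c *\<^sub>R x - y))\<^sup>2 / (2 * c)" using assms by simp
  also have "(norm (c *\<^sub>R x - y))\<^sup>2 = c\<^sup>2 * (norm x)\<^sup>2 - 2 * c * (x \<bullet> y) + (norm y)\<^sup>2"
    unfolding power2_norm_eq_inner
    by (simp add: inner_diff_left inner_diff_right inner_commute[of y x] power2_eq_square algebra_simps)
  finally show ?thesis using assms by (simp add: field_simps power2_eq_square)
qed

lemma young_minus:
  fixes x y :: "'a::real_inner"
  assumes "c > 0"
  shows "- (x \<bullet> y) \<le> c / 2 * (norm x)\<^sup>2 + 1 / (2 * c) * (norm y)\<^sup>2"
  using young[OF assms, of "- x" y] by simp

lemma norm_add_sq_le: "(norm (x + y))\<^sup>2 \<le> 2 * (norm x)\<^sup>2 + 2 * (norm y)\<^sup>2"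
  for x y :: "'a::real_inner"
  using young[of 1 x y] by (simp add: power2_norm_eq_inner inner_add_left inner_add_right inner_commute[of y x])

text \<open>The properties of the Laplacian \<open>T\<close> and of its pseudo-inverse \<open>P\<close> that enter the analysis of the linear
  part; \<open>r\<close> and \<open>r2\<close> play the roles of the spectral radius and the spectral gap.\<close>

locale pd_operators =
  fixes T P :: "'a::real_inner \<Rightarrow> 'a" and r r2 \<alpha> \<beta> :: real
  assumes lin_P: "linear P"
    and P_sym: "P x \<bullet> y = x \<bullet> P y"
    and T_norm: "norm (T x) \<le> r * norm x"
    and T_quad: "x \<bullet> T x \<le> r * (norm x)\<^sup>2"
    and P_nonneg: "0 \<le> x \<bullet> P x"
    and P_norm: "norm (P x) \<le> norm x / r2"
    and r2_pos: "0 < r2"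
    and \<beta>_pos: "0 < \<beta>" and \<alpha>_gt: "\<beta> < \<alpha>"
begin

definition energy :: "'a \<Rightarrow> 'a \<Rightarrow> real" where
  "energy e u = 1 / 2 * (norm e)\<^sup>2 + 1 / 2 * (u \<bullet> P u) + \<alpha> / (2 * \<beta>) * (norm u)\<^sup>2 + e \<bullet> u"

text \<open>An upper bound for the operator \<open>P + \<alpha> / \<beta>\<close> that weights the dual error in \<^term>\<open>energy\<close>.\<close>

definition dual_weight :: real where "dual_weight = 1 / r2 + \<alpha> / \<beta>"

lemma dual_weight_pos: "dual_weight > 0" using r2_pos \<beta>_pos \<alpha>_gt by (simp add: dual_weight_def add_pos_pos)

lemmas P_simps = linear_add[OF lin_P] linear_diff[OF lin_P] linear_scale[OF lin_P]

lemma P_quad: "x \<bullet> P x \<le> (norm x)\<^sup>2 / r2"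
proof -
  have "x \<bullet> P x \<le> norm x * norm (P x)" by (rule norm_cauchy_schwarz)
  also have "\<dots> \<le> norm x * (norm x / r2)" by (intro mult_left_mono P_norm) auto
  finally show ?thesis by (simp add: power2_eq_square)
qed

lemma energy_upper: "energy e u \<le> (norm e)\<^sup>2 + (1 + dual_weight) / 2 * (norm u)\<^sup>2"
proof -
  have "e \<bullet> u \<le> 1 / 2 * (norm e)\<^sup>2 + 1 / 2 * (norm u)\<^sup>2" using young[of 1 e u] by simp
  with P_quad[of u] show ?thesis by (simp add: energy_def dual_weight_def field_simps)
qed

text \<open>Complete the square in \<open>u\<close>. The factor is positive because \<open>\<alpha> > \<beta>\<close>.\<close>

lemma energy_lower: "1 / 2 * (1 - \<beta> / \<alpha>) * (norm e)\<^sup>2 \<le> energy e u"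
proof -
  have "- (u \<bullet> e) \<le> (\<alpha> / \<beta>) / 2 * (norm u)\<^sup>2 + 1 / (2 * (\<alpha> / \<beta>)) * (norm e)\<^sup>2"
    using \<beta>_pos \<alpha>_gt by (intro young_minus) simp
  moreover have "1 / (2 * (\<alpha> / \<beta>)) = 1 / 2 * (\<beta> / \<alpha>)" by simp
  ultimately show ?thesis using P_nonneg[of u] by (simp add: energy_def inner_commute[of e u] algebra_simps)
qed

lemma energy_nonneg: "0 \<le> energy e u"
proof -
  have "0 \<le> 1 / 2 * (1 - \<beta> / \<alpha>) * (norm e)\<^sup>2" using \<beta>_pos \<alpha>_gt by simp
  from this energy_lower[of e u] show ?thesis by (rule order_trans)
qed

text \<open>A nonnegative quadratic form satisfies Young's inequality: evaluate it at \<open>\<eta> (e, u) - (p, q)\<close>.\<close>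

lemma energy_perturb:
  assumes "\<eta> > 0"
  shows "energy (e + p) (u + q) \<le> (1 + \<eta>) * energy e u + (1 + 1 / \<eta>) * energy p q"
proof -
  define B where "B = e \<bullet> p + u \<bullet> P q + \<alpha> / \<beta> * (u \<bullet> q) + e \<bullet> q + p \<bullet> u"
  have comm: "q \<bullet> P u = u \<bullet> P q" using P_sym[of u q] by (simp add: inner_commute)
  have plus: "energy (e + p) (u + q) = energy e u + energy p q + B"
    unfolding energy_def B_def power2_norm_eq_inner
    by (simp add: P_simps inner_add_left inner_add_right comm inner_commute[of p e] inner_commute[of q u]
        add_divide_distrib ring_distribs)
  have "energy (\<eta> *\<^sub>R e - p) (\<eta> *\<^sub>R u - q) = \<eta>\<^sup>2 * energy e u + energy p q - \<eta> * B"
    unfolding energy_def B_def power2_norm_eq_inner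
    by (simp add: P_simps inner_diff_left inner_diff_right comm inner_commute[of p e] inner_commute[of q u]
        power2_eq_square algebra_simps)
  with energy_nonneg have "0 \<le> (\<eta>\<^sup>2 * energy e u + energy p q - \<eta> * B) / \<eta>" using assms by (metis divide_nonneg_pos)
  also have "\<dots> = \<eta> * energy e u + energy p q / \<eta> - B" using assms by (simp add: field_simps power2_eq_square)
  finally show ?thesis unfolding plus by (simp add: algebra_simps)
qed

text \<open>One step of the linear iteration with forcing terms \<open>\<delta>\<close> and \<open>d\<close>, and \<open>y\<close> in the role of \<open>T e\<close>. The products
  \<open>(e, u)\<close> and \<open>(u, y)\<close> of first order in \<open>h\<close> cancel: the first because \<open>P y = e\<close>, the second because of the
  weight \<open>\<alpha> / \<beta>\<close>.\<close>

lemma energy_step_eq: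
  assumes "P y = e"
  shows "energy (e - h *\<^sub>R (\<alpha> *\<^sub>R y + \<beta> *\<^sub>R u + \<delta>)) (u + (h * \<beta>) *\<^sub>R y + d) = energy e u
     - h * (\<alpha> - \<beta>) * (e \<bullet> y) - h * \<beta> * (norm u)\<^sup>2 - h * (e \<bullet> \<delta> + u \<bullet> \<delta>)
     + (e \<bullet> d + (P u \<bullet> d + \<alpha> / \<beta> * (u \<bullet> d)))
     + h\<^sup>2 / 2 * (norm (\<beta> *\<^sub>R u + ((\<alpha> - \<beta>) *\<^sub>R y + \<delta>)))\<^sup>2 - h\<^sup>2 * \<beta>\<^sup>2 / 2 * (norm y)\<^sup>2
     + (1 / 2 * (((h * \<beta>) *\<^sub>R y + d) \<bullet> P ((h * \<beta>) *\<^sub>R y + d)) + \<alpha> / (2 * \<beta>) * (norm ((h * \<beta>) *\<^sub>R y + d))\<^sup>2)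
     - h * (\<alpha> * (y \<bullet> d) + \<beta> * (u \<bullet> d) + \<delta> \<bullet> d)"
proof -
  define k where "k = \<alpha> / \<beta>"
  have \<alpha>: "\<alpha> = k * \<beta>" and k2: "\<alpha> / (2 * \<beta>) = k / 2" using \<beta>_pos by (auto simp: k_def)
  have Py: "y \<bullet> P u = e \<bullet> u" "y \<bullet> P d = e \<bullet> d" "P u \<bullet> d = u \<bullet> P d" "d \<bullet> P u = u \<bullet> P d"
    using P_sym[of y u] P_sym[of y d] P_sym[of u d] assms by (simp_all add: inner_commute)
  have comm: "y \<bullet> e = e \<bullet> y" "u \<bullet> e = e \<bullet> u" "\<delta> \<bullet> e = e \<bullet> \<delta>" "d \<bullet> e = e \<bullet> d" "u \<bullet> y = y \<bullet> u"
    "\<delta> \<bullet> y = y \<bullet> \<delta>" "d \<bullet> y = y \<bullet> d" "\<delta> \<bullet> u = u \<bullet> \<delta>" "d \<bullet> u = u \<bullet> d" "d \<bullet> \<delta> = \<delta> \<bullet> d"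
    by (simp_all add: inner_commute)
  show ?thesis
    unfolding energy_def power2_norm_eq_inner k2 k_def[symmetric]
    by (simp add: P_simps assms inner_add_left inner_add_right inner_diff_left inner_diff_right Py comm)
      (simp add: \<alpha> power2_eq_square field_simps)
qed

text \<open>Young's inequality on the remaining terms. Its weights are such that, for \<open>h \<epsilon>\<^sub>2 < 1\<close>, the damping of first
  order in \<open>h\<close> dominates what the terms of second order contribute to \<open>|e|\<^sup>2\<close> and \<open>|u|\<^sup>2\<close>, and that the
  coefficient of \<open>|d|\<^sup>2\<close> fits \<open>\<epsilon>\<^sub>3\<close> and \<open>\<epsilon>\<^sub>4\<close>.\<close>

lemma energy_drift:
  assumes inv: "P (T e) = e" and gap: "r2 * (norm e)\<^sup>2 \<le> e \<bullet> T e"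
    and \<delta>: "norm \<delta> \<le> l * norm e" and "0 < h"
  shows "energy (e - h *\<^sub>R (\<alpha> *\<^sub>R T e + \<beta> *\<^sub>R u + \<delta>)) (u + (h * \<beta>) *\<^sub>R T e + d) \<le> energy e u
     + (h * (- (\<alpha> - \<beta>) * r2 + 1 + l\<^sup>2)
        + h\<^sup>2 * (\<beta>\<^sup>2 * r + (\<alpha> * \<beta> + 2 * (\<alpha> - \<beta>)\<^sup>2 + \<alpha>\<^sup>2 / 2) * r\<^sup>2 + 5 / 2 * l\<^sup>2)) * (norm e)\<^sup>2
     + (h * (- \<beta> + 1 / 2 + dual_weight / (2 * \<beta>)) + h\<^sup>2 * (\<beta>\<^sup>2 + 1 / 2)) * (norm u)\<^sup>2
     + ((1 + dual_weight * \<beta>) / (2 * h) + dual_weight + 1 + \<beta>\<^sup>2 / 2) * (norm d)\<^sup>2"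
proof -
  define y where "y = T e"
  define E where "E = (norm e)\<^sup>2"
  define U where "U = (norm u)\<^sup>2"
  define D where "D = (norm d)\<^sup>2"
  have \<alpha>_pos: "\<alpha> > 0" using \<beta>_pos \<alpha>_gt by simp
  have y2: "(norm y)\<^sup>2 \<le> r\<^sup>2 * E"
    using power_mono[OF T_norm[of e], of 2] by (simp add: y_def E_def power_mult_distrib)
  have \<delta>2: "(norm \<delta>)\<^sup>2 \<le> l\<^sup>2 * E"
    using power_mono[OF \<delta>, of 2] by (simp add: E_def power_mult_distrib)
  have ey: "e \<bullet> y \<le> r * E" using T_quad by (simp add: y_def E_def)
  have b1: "- h * (\<alpha> - \<beta>) * (e \<bullet> y) \<le> h * (- (\<alpha> - \<beta>) * r2) * E"
    using mult_left_mono[OF gap, of "h * (\<alpha> - \<beta>)"] \<open>0 < h\<close> \<alpha>_gt by (simp add: y_def E_def algebra_simps)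
  have "- (e \<bullet> \<delta>) \<le> 1 / 2 * E + 1 / 2 * (norm \<delta>)\<^sup>2" using young_minus[of 1 e \<delta>] by (simp add: E_def)
  moreover have "- (u \<bullet> \<delta>) \<le> 1 / 2 * U + 1 / 2 * (norm \<delta>)\<^sup>2" using young_minus[of 1 u \<delta>] by (simp add: U_def)
  ultimately have "- (e \<bullet> \<delta> + u \<bullet> \<delta>) \<le> (1 / 2 + l\<^sup>2) * E + 1 / 2 * U"
    using \<delta>2 by (simp add: algebra_simps)
  from mult_left_mono[OF this, of h] \<open>0 < h\<close>
  have b2: "- h * (e \<bullet> \<delta> + u \<bullet> \<delta>) \<le> h * (1 / 2 + l\<^sup>2) * E + h / 2 * U"
    by (simp add: algebra_simps)
  have b3: "e \<bullet> d \<le> h / 2 * E + 1 / (2 * h) * D"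
    using young[OF \<open>0 < h\<close>, of e d] by (simp add: E_def D_def)
  have b4: "P u \<bullet> d + \<alpha> / \<beta> * (u \<bullet> d) \<le> h * dual_weight / (2 * \<beta>) * U + dual_weight * \<beta> / (2 * h) * D"
  proof -
    have "P u \<bullet> d \<le> norm (P u) * norm d" by (rule norm_cauchy_schwarz)
    also have "\<dots> \<le> norm u / r2 * norm d" by (intro mult_right_mono P_norm) auto
    finally have 1: "P u \<bullet> d \<le> 1 / r2 * (norm u * norm d)" by simp
    have 2: "\<alpha> / \<beta> * (u \<bullet> d) \<le> \<alpha> / \<beta> * (norm u * norm d)"
      using \<alpha>_pos \<beta>_pos by (intro mult_left_mono norm_cauchy_schwarz) auto
    have "norm u * norm d \<le> (h / \<beta>) / 2 * U + 1 / (2 * (h / \<beta>)) * D"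
      using young[of "h / \<beta>" "norm u" "norm d"] \<open>0 < h\<close> \<beta>_pos by (simp add: U_def D_def)
    from mult_left_mono[OF this, of dual_weight] dual_weight_pos
    have "dual_weight * (norm u * norm d) \<le> h * dual_weight / (2 * \<beta>) * U + dual_weight * \<beta> / (2 * h) * D"
      using \<open>0 < h\<close> \<beta>_pos by (simp add: field_simps)
    with 1 2 show ?thesis by (simp add: dual_weight_def algebra_simps)
  qed
  have b5: "h\<^sup>2 / 2 * (norm (\<beta> *\<^sub>R u + ((\<alpha> - \<beta>) *\<^sub>R y + \<delta>)))\<^sup>2
      \<le> h\<^sup>2 * \<beta>\<^sup>2 * U + h\<^sup>2 * (2 * (\<alpha> - \<beta>)\<^sup>2 * r\<^sup>2 + 2 * l\<^sup>2) * E"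
  proof -
    have "(norm (\<beta> *\<^sub>R u + ((\<alpha> - \<beta>) *\<^sub>R y + \<delta>)))\<^sup>2
        \<le> 2 * (\<beta>\<^sup>2 * U) + 2 * (2 * ((\<alpha> - \<beta>)\<^sup>2 * (norm y)\<^sup>2) + 2 * (norm \<delta>)\<^sup>2)"
      using norm_add_sq_le[of "\<beta> *\<^sub>R u" "(\<alpha> - \<beta>) *\<^sub>R y + \<delta>"] norm_add_sq_le[of "(\<alpha> - \<beta>) *\<^sub>R y" \<delta>]
      by (simp add: U_def power_mult_distrib)
    also have "\<dots> \<le> 2 * (\<beta>\<^sup>2 * U) + 2 * (2 * ((\<alpha> - \<beta>)\<^sup>2 * (r\<^sup>2 * E)) + 2 * (l\<^sup>2 * E))"
      using y2 \<delta>2 by (intro add_mono mult_left_mono) auto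
    finally have *: "(norm (\<beta> *\<^sub>R u + ((\<alpha> - \<beta>) *\<^sub>R y + \<delta>)))\<^sup>2 \<le> \<dots>" .
    show ?thesis using mult_left_mono[OF *, of "h\<^sup>2 / 2"] by (simp add: algebra_simps)
  qed
  have b6: "1 / 2 * (((h * \<beta>) *\<^sub>R y + d) \<bullet> P ((h * \<beta>) *\<^sub>R y + d)) + \<alpha> / (2 * \<beta>) * (norm ((h * \<beta>) *\<^sub>R y + d))\<^sup>2
      \<le> h\<^sup>2 * (\<beta>\<^sup>2 * r + \<alpha> * \<beta> * r\<^sup>2) * E + dual_weight * D"
  proof -
    have "0 \<le> ((h * \<beta>) *\<^sub>R y - d) \<bullet> P ((h * \<beta>) *\<^sub>R y - d)" by (rule P_nonneg)
    then have "((h * \<beta>) *\<^sub>R y + d) \<bullet> P ((h * \<beta>) *\<^sub>R y + d)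
       \<le> 2 * (((h * \<beta>) *\<^sub>R y) \<bullet> P ((h * \<beta>) *\<^sub>R y)) + 2 * (d \<bullet> P d)"
      by (simp add: P_simps inner_add_left inner_add_right inner_diff_left inner_diff_right algebra_simps)
    also have "((h * \<beta>) *\<^sub>R y) \<bullet> P ((h * \<beta>) *\<^sub>R y) = h\<^sup>2 * \<beta>\<^sup>2 * (e \<bullet> y)"
      using inv by (simp add: P_simps y_def power2_eq_square inner_commute)
    also have "2 * (h\<^sup>2 * \<beta>\<^sup>2 * (e \<bullet> y)) + 2 * (d \<bullet> P d) \<le> 2 * (h\<^sup>2 * \<beta>\<^sup>2 * (r * E)) + 2 * (D / r2)"
      using ey P_quad[of d] by (intro add_mono mult_left_mono) (auto simp: D_def)
    finally have 1: "1 / 2 * (((h * \<beta>) *\<^sub>R y + d) \<bullet> P ((h * \<beta>) *\<^sub>R y + d)) \<le> h\<^sup>2 * \<beta>\<^sup>2 * (r * E) + D / r2"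
      by linarith
    have "(norm ((h * \<beta>) *\<^sub>R y + d))\<^sup>2 \<le> 2 * ((h * \<beta>)\<^sup>2 * (norm y)\<^sup>2) + 2 * D"
      using norm_add_sq_le[of "(h * \<beta>) *\<^sub>R y" d] by (simp add: power_mult_distrib D_def)
    also have "\<dots> \<le> 2 * ((h * \<beta>)\<^sup>2 * (r\<^sup>2 * E)) + 2 * D"
      using y2 by (intro add_mono mult_left_mono) auto
    finally have "\<alpha> / (2 * \<beta>) * (norm ((h * \<beta>) *\<^sub>R y + d))\<^sup>2 \<le> \<alpha> / (2 * \<beta>) * (2 * ((h * \<beta>)\<^sup>2 * (r\<^sup>2 * E)) + 2 * D)"
      using \<alpha>_pos \<beta>_pos by (intro mult_left_mono) auto
    also have "\<dots> = h\<^sup>2 * (\<alpha> * \<beta> * r\<^sup>2) * E + \<alpha> / \<beta> * D"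
      using \<beta>_pos by (simp add: field_simps power2_eq_square)
    finally show ?thesis using 1 by (simp add: dual_weight_def algebra_simps)
  qed
  have b7: "- h * (\<alpha> * (y \<bullet> d) + \<beta> * (u \<bullet> d) + \<delta> \<bullet> d)
      \<le> h\<^sup>2 * (\<alpha>\<^sup>2 / 2 * r\<^sup>2 + 1 / 2 * l\<^sup>2) * E + h\<^sup>2 / 2 * U + (1 + \<beta>\<^sup>2 / 2) * D"
  proof -
    have "- (((h * \<alpha>) *\<^sub>R y) \<bullet> d) \<le> 1 / 2 * (h\<^sup>2 * \<alpha>\<^sup>2 * (norm y)\<^sup>2) + 1 / 2 * D"
      using young_minus[of 1 "(h * \<alpha>) *\<^sub>R y" d] by (simp add: D_def power_mult_distrib)
    also have "\<dots> \<le> 1 / 2 * (h\<^sup>2 * \<alpha>\<^sup>2 * (r\<^sup>2 * E)) + 1 / 2 * D"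
      using y2 by (intro add_mono mult_left_mono) auto
    finally have 1: "- h * \<alpha> * (y \<bullet> d) \<le> 1 / 2 * (h\<^sup>2 * \<alpha>\<^sup>2 * (r\<^sup>2 * E)) + 1 / 2 * D" by simp
    have "- ((h *\<^sub>R \<delta>) \<bullet> d) \<le> 1 / 2 * (h\<^sup>2 * (norm \<delta>)\<^sup>2) + 1 / 2 * D"
      using young_minus[of 1 "h *\<^sub>R \<delta>" d] by (simp add: D_def power_mult_distrib)
    also have "\<dots> \<le> 1 / 2 * (h\<^sup>2 * (l\<^sup>2 * E)) + 1 / 2 * D"
      using \<delta>2 by (intro add_mono mult_left_mono) auto
    finally have 2: "- h * (\<delta> \<bullet> d) \<le> 1 / 2 * (h\<^sup>2 * (l\<^sup>2 * E)) + 1 / 2 * D" by simp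
    have 3: "- h * \<beta> * (u \<bullet> d) \<le> 1 / 2 * (h\<^sup>2 * U) + 1 / 2 * (\<beta>\<^sup>2 * D)"
      using young_minus[of 1 "h *\<^sub>R u" "\<beta> *\<^sub>R d"] by (simp add: D_def U_def power_mult_distrib mult_ac)
    show ?thesis using 1 2 3 by (simp add: algebra_simps)
  qed
  have b8: "- (h\<^sup>2 * \<beta>\<^sup>2 / 2 * (norm y)\<^sup>2) \<le> 0" by simp
  have eq: "P y = e" using inv by (simp add: y_def)
  have "energy (e - h *\<^sub>R (\<alpha> *\<^sub>R y + \<beta> *\<^sub>R u + \<delta>)) (u + (h * \<beta>) *\<^sub>R y + d) \<le> energy e u
     + h * (- (\<alpha> - \<beta>) * r2) * E - h * \<beta> * U + (h * (1 / 2 + l\<^sup>2) * E + h / 2 * U)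
     + (h / 2 * E + 1 / (2 * h) * D + (h * dual_weight / (2 * \<beta>) * U + dual_weight * \<beta> / (2 * h) * D))
     + (h\<^sup>2 * \<beta>\<^sup>2 * U + h\<^sup>2 * (2 * (\<alpha> - \<beta>)\<^sup>2 * r\<^sup>2 + 2 * l\<^sup>2) * E)
     + (h\<^sup>2 * (\<beta>\<^sup>2 * r + \<alpha> * \<beta> * r\<^sup>2) * E + dual_weight * D)
     + (h\<^sup>2 * (\<alpha>\<^sup>2 / 2 * r\<^sup>2 + 1 / 2 * l\<^sup>2) * E + h\<^sup>2 / 2 * U + (1 + \<beta>\<^sup>2 / 2) * D)"
    unfolding energy_step_eq[OF eq] using b1 b2 b3 b4 b5 b6 b7 b8 unfolding U_def[symmetric] by linarith
  also have "\<dots> = energy e u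
     + (h * (- (\<alpha> - \<beta>) * r2 + 1 + l\<^sup>2)
        + h\<^sup>2 * (\<beta>\<^sup>2 * r + (\<alpha> * \<beta> + 2 * (\<alpha> - \<beta>)\<^sup>2 + \<alpha>\<^sup>2 / 2) * r\<^sup>2 + 5 / 2 * l\<^sup>2)) * E
     + (h * (- \<beta> + 1 / 2 + dual_weight / (2 * \<beta>)) + h\<^sup>2 * (\<beta>\<^sup>2 + 1 / 2)) * U
     + ((1 + dual_weight * \<beta>) / (2 * h) + dual_weight + 1 + \<beta>\<^sup>2 / 2) * D"
    by (simp add: ring_distribs add_divide_distrib)
  finally show ?thesis by (simp only: y_def E_def U_def D_def)
qed

end

section \<open>Decrease along the noise-free iteration\<close>

lemma norm_vec_sq: "(norm X)\<^sup>2 = (\<Sum>i\<in>UNIV. (norm (X $ i))\<^sup>2)" for X :: "'a::real_inner ^ 'n"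
  by (simp add: power2_norm_eq_inner inner_vec_def)

text \<open>The last four assumptions are the consequences of the parameter conditions that the decrease of the
  Lyapunov function rests on: damping of \<open>e\<close>, damping of \<open>u\<close>, and the two step-size bounds.\<close>

locale primal_dual = graph_laplacian A L for A L :: "real ^ 'n::finite ^ 'n" +
  fixes f :: "'n \<Rightarrow> real ^ 'd::finite \<Rightarrow> real" and F :: "real ^ 'd \<Rightarrow> real"
    and Lf \<nu> \<alpha> \<beta> h :: real
  assumes F_eq: "F = (\<lambda>y. \<Sum>i\<in>UNIV. f i y)"
    and argmin_nonempty: "argmin_set F \<noteq> {}"
    and f_diff: "f i differentiable (at y)"
    and f_lip: "norm (gradient (f i) y - gradient (f i) z) \<le> Lf * norm (y - z)"
    and Lf_pos: "0 < Lf"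
    and \<nu>_pos: "0 < \<nu>"
    and PL: "1 / 2 * (norm (gradient F y))\<^sup>2 \<ge> \<nu> * (F y - min_value F)"
    and \<beta>_pos: "0 < \<beta>" and h_pos: "0 < h"
    and gain: "4 + 3 / 2 * Lf\<^sup>2 \<le> (\<alpha> - \<beta>) * min_nonzero_eigenvalue L"
    and coupling: "1 \<le> \<beta> - 1 / 2 - (1 / min_nonzero_eigenvalue L + \<alpha> / \<beta>) / (2 * \<beta>)"
    and h_eps2: "h * eps2 \<alpha> \<beta> (spectral_radius L) Lf < 1"
    and h_eps4: "h * eps4 \<alpha> \<beta> (min_nonzero_eigenvalue L) Lf < eps3 \<alpha> \<beta> (min_nonzero_eigenvalue L) Lf"
begin

abbreviation "\<rho> \<equiv> spectral_radius L"
abbreviation "\<rho>2 \<equiv> min_nonzero_eigenvalue L"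
abbreviation "m \<equiv> min_value F"

definition grad :: "real ^ 'd ^ 'n \<Rightarrow> real ^ 'd ^ 'n" where
  "grad X = (\<chi> i. gradient (f i) (X $ i))"

text \<open>Restricted to vectors of mean zero, the pseudo-inverse of the Laplacian.\<close>

definition lap_pinv :: "real ^ 'd ^ 'n \<Rightarrow> real ^ 'd ^ 'n" where
  "lap_pinv = (SOME Q. linear Q \<and> (\<forall>X. mean X = 0 \<longrightarrow> Q (lap_op L X) = X) \<and>
      (\<forall>X Y. Q X \<bullet> Y = X \<bullet> Q Y) \<and> (\<forall>X. 0 \<le> X \<bullet> Q X) \<and> (\<forall>X. norm (Q X) \<le> norm X / \<rho>2))"

lemma lap_pinv: "linear lap_pinv \<and> (\<forall>X. mean X = 0 \<longrightarrow> lap_pinv (lap_op L X) = X) \<and>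
      (\<forall>X Y. lap_pinv X \<bullet> Y = X \<bullet> lap_pinv Y) \<and> (\<forall>X. 0 \<le> X \<bullet> lap_pinv X) \<and>
      (\<forall>X. norm (lap_pinv X) \<le> norm X / \<rho>2)"
proof -
  have "\<exists>Q :: real ^ 'd ^ 'n \<Rightarrow> real ^ 'd ^ 'n. linear Q \<and> (\<forall>X. mean X = 0 \<longrightarrow> Q (lap_op L X) = X) \<and>
      (\<forall>X Y. Q X \<bullet> Y = X \<bullet> Q Y) \<and> (\<forall>X. 0 \<le> X \<bullet> Q X) \<and> (\<forall>X. norm (Q X) \<le> norm X / \<rho>2)"
    by (rule pseudo_inverse[where ?'d = 'd]) blast
  from someI_ex[OF this] show ?thesis unfolding lap_pinv_def[symmetric] .
qed

lemma \<alpha>_gt: "\<beta> < \<alpha>"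
proof -
  have "0 < (\<alpha> - \<beta>) * \<rho>2" using gain zero_le_power2[of Lf] by linarith
  then show ?thesis using spectral_gap(1) by (simp add: zero_less_mult_iff)
qed

lemma n_pos: "0 < real CARD('n)" by simp

sublocale pd: pd_operators "lap_op L :: real ^ 'd ^ 'n \<Rightarrow> _" lap_pinv \<rho> \<rho>2 \<alpha> \<beta>
proof (intro pd_operators.intro)
  show "x \<bullet> lap_op L x \<le> \<rho> * (norm x)\<^sup>2" for x :: "real ^ 'd ^ 'n"
    by (rule spectral_radius_bound)
qed (use lap_pinv norm_lap_op_le spectral_radius_pos spectral_gap(1) \<alpha>_gt \<beta>_pos in \<open>blast intro: less_imp_le\<close>)+

lemma grad_lipschitz: "norm (grad X - grad Y) \<le> Lf * norm (X - Y)"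
proof (rule power2_le_imp_le)
  have "(norm (grad X - grad Y))\<^sup>2 \<le> (\<Sum>i\<in>UNIV. (Lf * norm ((X - Y) $ i))\<^sup>2)"
    unfolding norm_vec_sq[of "grad X - grad Y"] by (intro sum_mono power_mono) (auto simp: grad_def f_lip)
  also have "\<dots> = (Lf * norm (X - Y))\<^sup>2"
    by (simp add: norm_vec_sq[of "X - Y"] power_mult_distrib sum_distrib_left)
  finally show "(norm (grad X - grad Y))\<^sup>2 \<le> (Lf * norm (X - Y))\<^sup>2" .
qed (use Lf_pos in simp)

lemma grad_lipschitz_sq: "(norm (grad X - grad Y))\<^sup>2 \<le> Lf\<^sup>2 * (norm (X - Y))\<^sup>2"
  using power_mono[OF grad_lipschitz[of X Y], of 2] by (simp add: power_mult_distrib)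

lemma grad_replicated_lipschitz_sq:
  "(norm (grad (replicated y) - grad (replicated z)))\<^sup>2 \<le> Lf\<^sup>2 * (real CARD('n) * (norm (y - z))\<^sup>2)"
  using grad_lipschitz_sq[of "replicated y" "replicated z"]
  by (simp add: linear_diff[OF linear_replicated, symmetric] norm_replicated)

lemma F_GDERIV: "GDERIV F y :> real CARD('n) *\<^sub>R mean (grad (replicated y))"
proof -
  have "((\<lambda>y. \<Sum>i\<in>UNIV. f i y) has_derivative (\<lambda>d. \<Sum>i\<in>UNIV. d \<bullet> gradient (f i) y)) (at y)"
    using GDERIV_gradient[OF f_diff] unfolding gderiv_def by (intro has_derivative_sum) auto
  then show ?thesis
    by (simp add: gderiv_def F_eq sum_eq_mean[symmetric] inner_sum_right grad_def replicated_def)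
qed

lemma gradient_F: "gradient F y = real CARD('n) *\<^sub>R mean (grad (replicated y))"
  by (rule gradient_eq[OF F_GDERIV])

sublocale F: smooth_fun F "gradient F" "real CARD('n) * Lf"
proof
  fix y z
  show "GDERIV F y :> gradient F y" using F_GDERIV gradient_F by simp
  have "norm (gradient F y - gradient F z) = norm (\<Sum>i\<in>UNIV. gradient (f i) y - gradient (f i) z)"
    by (simp add: gradient_F sum_eq_mean[symmetric] grad_def replicated_def sum_subtractf)
  also have "\<dots> \<le> (\<Sum>i\<in>(UNIV::'n set). Lf * norm (y - z))"
    by (rule sum_norm_le) (rule f_lip)
  finally show "norm (gradient F y - gradient F z) \<le> real CARD('n) * Lf * norm (y - z)" by simp
qed (use Lf_pos in simp)

lemma m_le: "m \<le> F y" and argmin_set_eq: "argmin_set F = {z. F z = m}"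
proof -
  obtain z where z: "\<And>y. F z \<le> F y"
    using argmin_nonempty by (auto simp: argmin_set_def is_arg_min_linorder)
  have m: "m = F z" unfolding min_value_def
    by (rule cInf_eq_minimum) (use z in auto)
  show "m \<le> F y" using z m by simp
  show "argmin_set F = {z. F z = m}"
    unfolding argmin_set_def is_arg_min_linorder using z m by (auto intro: antisym)
qed

text \<open>The dual variable measured against its equilibrium value at the current average. Centering makes
  it comparable with the dual iterates, which have mean zero.\<close>

definition dual :: "real ^ 'd ^ 'n \<Rightarrow> real ^ 'd ^ 'n \<Rightarrow> real ^ 'd ^ 'n" where
  "dual X V = centered (V + (1 / \<beta>) *\<^sub>R grad (replicated (mean X)))"

definition lyap :: "real ^ 'd ^ 'n \<Rightarrow> real ^ 'd ^ 'n \<Rightarrow> real" where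
  "lyap X V = pd.energy (centered X) (dual X V) + (F (mean X) - m)"

definition next_primal :: "real ^ 'd ^ 'n \<Rightarrow> real ^ 'd ^ 'n \<Rightarrow> real ^ 'd ^ 'n" where
  "next_primal X V = X - h *\<^sub>R (\<alpha> *\<^sub>R lap_op L X + \<beta> *\<^sub>R V + grad X)"

definition next_dual :: "real ^ 'd ^ 'n \<Rightarrow> real ^ 'd ^ 'n \<Rightarrow> real ^ 'd ^ 'n" where
  "next_dual X V = V + (h * \<beta>) *\<^sub>R lap_op L X"

lemma lyap_nonneg: "0 \<le> lyap X V"
  using pd.energy_nonneg m_le[of "mean X"] by (simp add: lyap_def)

lemma lyap_upper:
  "lyap X V \<le> (1 + pd.dual_weight) * ((norm (centered X))\<^sup>2 + (norm (dual X V))\<^sup>2 + (F (mean X) - m))"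
proof -
  have "(norm (centered X))\<^sup>2 \<le> (1 + pd.dual_weight) * (norm (centered X))\<^sup>2"
    using mult_right_mono[of 1 "1 + pd.dual_weight" "(norm (centered X))\<^sup>2"] pd.dual_weight_pos by simp
  moreover have "(1 + pd.dual_weight) / 2 * (norm (dual X V))\<^sup>2 \<le> (1 + pd.dual_weight) * (norm (dual X V))\<^sup>2"
    using pd.dual_weight_pos by (intro mult_right_mono) auto
  moreover have "F (mean X) - m \<le> (1 + pd.dual_weight) * (F (mean X) - m)"
    using mult_right_mono[of 1 "1 + pd.dual_weight" "F (mean X) - m"] pd.dual_weight_pos m_le by simp
  ultimately show ?thesis
    using pd.energy_upper[of "centered X" "dual X V"] unfolding lyap_def distrib_left by linarith
qed

lemmas linear_simps =
  linear_add[OF linear_mean] linear_diff[OF linear_mean] linear_scale[OF linear_mean]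
  linear_add[OF linear_centered] linear_diff[OF linear_centered] linear_scale[OF linear_centered]
  linear_add[OF linear_lap_op] linear_diff[OF linear_lap_op] linear_scale[OF linear_lap_op]

lemma centered_lap_op [simp]: "centered (lap_op L X) = lap_op L X"
  by (simp add: centered_eq)

text \<open>The descent lemma for \<open>F\<close> supplies \<open>- h n / 2\<close> times the squared norm of the mean gradient. This pays
  for the drift \<open>d\<close> of the equilibrium value of the dual variable: \<open>\<epsilon>\<^sub>3\<close> bounds from below what remains after
  its cost of first order in \<open>h\<close>, and \<open>\<epsilon>\<^sub>4\<close> bounds the cost of second order.\<close>

lemma lyap_next:
  assumes "mean V = 0"
  shows "lyap (next_primal X V) (next_dual X V) \<le> lyap X V
    - h * min (min 1 (1 - h * eps2 \<alpha> \<beta> \<rho> Lf)) (\<nu> / real CARD('n)) *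
      ((norm (centered X))\<^sup>2 + (norm (dual X V))\<^sup>2 + (F (mean X) - m))"
proof -
  define X' where "X' = next_primal X V"
  define e where "e = centered X"
  define u where "u = dual X V"
  define gb where "gb = mean (grad X)"
  define g0 where "g0 = mean (grad (replicated (mean X)))"
  define \<delta> where "\<delta> = centered (grad X - grad (replicated (mean X)))"
  define d where "d = (1 / \<beta>) *\<^sub>R centered (grad (replicated (mean X')) - grad (replicated (mean X)))"
  define E where "E = (norm e)\<^sup>2"
  define U where "U = (norm u)\<^sup>2"
  define G where "G = real CARD('n) * (norm gb)\<^sup>2"
  define Q where "Q = F (mean X) - m"
  have pos: "0 \<le> E" "0 \<le> U" "0 \<le> G" "0 \<le> Q"
    using m_le[of "mean X"] by (auto simp: E_def U_def G_def Q_def)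
  have mean_X': "mean X' = mean X - h *\<^sub>R gb"
    using assms by (simp add: X'_def next_primal_def linear_simps gb_def)
  have X_e: "X - replicated (mean X) = e" by (simp add: e_def centered_def)
  have lap_e: "lap_op L e = lap_op L X" by (simp add: e_def)
  have \<beta>u: "\<beta> *\<^sub>R u = \<beta> *\<^sub>R centered V + centered (grad (replicated (mean X)))"
    using \<beta>_pos by (simp add: u_def dual_def linear_simps scaleR_add_right)
  have e': "centered X' = e - h *\<^sub>R (\<alpha> *\<^sub>R lap_op L e + \<beta> *\<^sub>R u + \<delta>)"
    unfolding \<beta>u by (simp add: X'_def next_primal_def lap_e \<delta>_def linear_simps e_def[symmetric])
  have u': "dual X' (next_dual X V) = u + (h * \<beta>) *\<^sub>R lap_op L e + d"
    by (simp add: dual_def next_dual_def lap_e d_def u_def linear_simps scaleR_diff_right)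
  have \<delta>_raw: "norm (grad X - grad (replicated (mean X))) \<le> Lf * norm e"
    using grad_lipschitz[of X "replicated (mean X)"] by (simp add: X_e)
  have \<delta>: "norm \<delta> \<le> Lf * norm e"
    unfolding \<delta>_def using norm_centered_le \<delta>_raw by (rule order_trans)
  have d2: "(norm d)\<^sup>2 \<le> Lf\<^sup>2 * h\<^sup>2 / \<beta>\<^sup>2 * G"
  proof -
    have "(norm (centered (grad (replicated (mean X')) - grad (replicated (mean X)))))\<^sup>2
        \<le> (norm (grad (replicated (mean X')) - grad (replicated (mean X))))\<^sup>2"
      by (intro power_mono norm_centered_le) auto
    also have "\<dots> \<le> Lf\<^sup>2 * (real CARD('n) * (norm (mean X' - mean X))\<^sup>2)" by (rule grad_replicated_lipschitz_sq)
    also have "\<dots> = Lf\<^sup>2 * h\<^sup>2 * G" by (simp add: mean_X' G_def power_mult_distrib)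
    finally have *: "(norm (centered (grad (replicated (mean X')) - grad (replicated (mean X)))))\<^sup>2 \<le> Lf\<^sup>2 * h\<^sup>2 * G" .
    show ?thesis using divide_right_mono[OF *, of "\<beta>\<^sup>2"] \<beta>_pos
      by (simp add: d_def power_divide)
  qed
  have gap: "\<rho>2 * (norm e)\<^sup>2 \<le> e \<bullet> lap_op L e"
    by (rule spectral_gap(3)) (simp add: e_def)
  have "mean e = 0" by (simp add: e_def)
  then have inv: "lap_pinv (lap_op L e) = e" using lap_pinv by blast
  have "pd.energy (centered X') (dual X' (next_dual X V)) \<le> pd.energy e u
     + (h * (- (\<alpha> - \<beta>) * \<rho>2 + 1 + Lf\<^sup>2)
        + h\<^sup>2 * (\<beta>\<^sup>2 * \<rho> + (\<alpha> * \<beta> + 2 * (\<alpha> - \<beta>)\<^sup>2 + \<alpha>\<^sup>2 / 2) * \<rho>\<^sup>2 + 5 / 2 * Lf\<^sup>2)) * E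
     + (h * (- \<beta> + 1 / 2 + pd.dual_weight / (2 * \<beta>)) + h\<^sup>2 * (\<beta>\<^sup>2 + 1 / 2)) * U
     + ((1 + pd.dual_weight * \<beta>) / (2 * h) + pd.dual_weight + 1 + \<beta>\<^sup>2 / 2) * (norm d)\<^sup>2"
    unfolding e' u' E_def U_def using pd.energy_drift[OF inv gap \<delta> h_pos] by simp
  also have "\<dots> \<le> pd.energy e u
     + (h * (- (\<alpha> - \<beta>) * \<rho>2 + 1 + Lf\<^sup>2)
        + h\<^sup>2 * (\<beta>\<^sup>2 * \<rho> + (\<alpha> * \<beta> + 2 * (\<alpha> - \<beta>)\<^sup>2 + \<alpha>\<^sup>2 / 2) * \<rho>\<^sup>2 + 5 / 2 * Lf\<^sup>2)) * E
     + (h * (- \<beta> + 1 / 2 + pd.dual_weight / (2 * \<beta>)) + h\<^sup>2 * (\<beta>\<^sup>2 + 1 / 2)) * U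
     + ((1 + pd.dual_weight * \<beta>) / (2 * h) + pd.dual_weight + 1 + \<beta>\<^sup>2 / 2) * (Lf\<^sup>2 * h\<^sup>2 / \<beta>\<^sup>2 * G)"
    using d2 pd.dual_weight_pos \<beta>_pos h_pos by (intro add_left_mono mult_left_mono) auto
  finally have W': "pd.energy (centered X') (dual X' (next_dual X V)) \<le> \<dots>" .
  have F': "F (mean X') - m \<le> Q - h * (\<nu> / real CARD('n)) * Q - h / 2 * G + h / 2 * Lf\<^sup>2 * E + h\<^sup>2 * Lf / 2 * G"
  proof -
    have "F (mean X') \<le> F (mean X) - h * real CARD('n) * (g0 \<bullet> gb) + h\<^sup>2 * Lf / 2 * G"
      using F.descent[of "mean X" "- (h *\<^sub>R gb)"]
      by (simp add: mean_X' gradient_F g0_def[symmetric] G_def power_mult_distrib mult_ac)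
    \<comment> \<open>polarization exposes the squares of the actual mean gradient and of the gradient at the average\<close>
    moreover have "- h * real CARD('n) * (g0 \<bullet> gb) = h / 2 * (real CARD('n) * (norm (gb - g0))\<^sup>2) - h / 2 * G - h / 2 * (real CARD('n) * (norm g0)\<^sup>2)"
      unfolding G_def power2_norm_eq_inner
      by (simp add: inner_diff_left inner_diff_right inner_commute[of gb g0] field_simps)
    moreover have "real CARD('n) * (norm (gb - g0))\<^sup>2 \<le> Lf\<^sup>2 * E"
    proof -
      have "real CARD('n) * (norm (gb - g0))\<^sup>2 \<le> (norm (grad X - grad (replicated (mean X))))\<^sup>2"
        unfolding gb_def g0_def linear_diff[OF linear_mean, symmetric] by (rule norm_mean_le)
      also have "\<dots> \<le> Lf\<^sup>2 * E"
        using grad_lipschitz_sq[of X "replicated (mean X)"] by (simp add: X_e E_def)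
      finally show ?thesis .
    qed
    then have "h / 2 * (real CARD('n) * (norm (gb - g0))\<^sup>2) \<le> h / 2 * Lf\<^sup>2 * E"
      using h_pos mult_left_mono[of _ "Lf\<^sup>2 * E" "h / 2"] by (simp add: mult.assoc)
    moreover have "h * (\<nu> / real CARD('n)) * Q \<le> h / 2 * (real CARD('n) * (norm g0)\<^sup>2)"
    proof -
      have "\<nu> * Q \<le> 1 / 2 * ((real CARD('n))\<^sup>2 * (norm g0)\<^sup>2)"
        using PL[of "mean X"] by (simp add: gradient_F g0_def[symmetric] Q_def power_mult_distrib)
      from mult_left_mono[OF this, of "h / real CARD('n)"] h_pos n_pos
      show ?thesis by (simp add: power2_eq_square)
    qed
    ultimately show ?thesis by (simp add: Q_def)
  qed
  \<comment> \<open>the spectral gap leaves a damping of \<open>3 h\<close>, of which the terms of second order use less than \<open>2 h\<close>\<close>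
  have cE: "h * (- (\<alpha> - \<beta>) * \<rho>2 + 1 + Lf\<^sup>2)
        + h\<^sup>2 * (\<beta>\<^sup>2 * \<rho> + (\<alpha> * \<beta> + 2 * (\<alpha> - \<beta>)\<^sup>2 + \<alpha>\<^sup>2 / 2) * \<rho>\<^sup>2 + 5 / 2 * Lf\<^sup>2) + h / 2 * Lf\<^sup>2 \<le> - h"
  proof -
    have "\<alpha> * \<beta> + 2 * (\<alpha> - \<beta>)\<^sup>2 + \<alpha>\<^sup>2 / 2 \<le> 2 * (2 * \<alpha>\<^sup>2 + \<beta>\<^sup>2)"
      using \<alpha>_gt \<beta>_pos by (simp add: power2_eq_square algebra_simps)
    then have "(\<alpha> * \<beta> + 2 * (\<alpha> - \<beta>)\<^sup>2 + \<alpha>\<^sup>2 / 2) * \<rho>\<^sup>2 \<le> 2 * (2 * \<alpha>\<^sup>2 + \<beta>\<^sup>2) * \<rho>\<^sup>2"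
      by (rule mult_right_mono) simp
    moreover have "\<beta>\<^sup>2 * \<rho> \<ge> 0" using spectral_radius_pos by simp
    moreover have "\<beta>\<^sup>2 * \<rho> + (2 * \<alpha>\<^sup>2 + \<beta>\<^sup>2) * \<rho>\<^sup>2 + 5 / 2 * Lf\<^sup>2 \<le> eps2 \<alpha> \<beta> \<rho> Lf"
      unfolding eps2_def by simp
    ultimately have "\<beta>\<^sup>2 * \<rho> + (\<alpha> * \<beta> + 2 * (\<alpha> - \<beta>)\<^sup>2 + \<alpha>\<^sup>2 / 2) * \<rho>\<^sup>2 + 5 / 2 * Lf\<^sup>2 \<le> 2 * eps2 \<alpha> \<beta> \<rho> Lf"
      using zero_le_power2[of Lf] by linarith
    from mult_left_mono[OF this, of "h\<^sup>2"]
    have 1: "h\<^sup>2 * (\<beta>\<^sup>2 * \<rho> + (\<alpha> * \<beta> + 2 * (\<alpha> - \<beta>)\<^sup>2 + \<alpha>\<^sup>2 / 2) * \<rho>\<^sup>2 + 5 / 2 * Lf\<^sup>2)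
        \<le> 2 * h * (h * eps2 \<alpha> \<beta> \<rho> Lf)"
      by (simp add: power2_eq_square mult_ac)
    have 2: "2 * h * (h * eps2 \<alpha> \<beta> \<rho> Lf) \<le> 2 * h * 1"
      using h_eps2 h_pos by (intro mult_left_mono) auto
    have "h * (- (\<alpha> - \<beta>) * \<rho>2 + 1 + Lf\<^sup>2 + 1 / 2 * Lf\<^sup>2) \<le> h * (- 3)"
      using gain h_pos by (intro mult_left_mono) (simp_all add: algebra_simps)
    with 1 2 show ?thesis by (simp add: algebra_simps)
  qed
  have cU: "h * (- \<beta> + 1 / 2 + pd.dual_weight / (2 * \<beta>)) + h\<^sup>2 * (\<beta>\<^sup>2 + 1 / 2) \<le> - (h * (1 - h * eps2 \<alpha> \<beta> \<rho> Lf))"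
  proof -
    have "\<beta>\<^sup>2 + 1 / 2 \<le> eps2 \<alpha> \<beta> \<rho> Lf" unfolding eps2_def by (rule max.coboundedI2) simp
    from mult_left_mono[OF this, of "h\<^sup>2"]
    have 1: "h\<^sup>2 * (\<beta>\<^sup>2 + 1 / 2) \<le> h * (h * eps2 \<alpha> \<beta> \<rho> Lf)" by (simp add: power2_eq_square mult_ac)
    have "- \<beta> + 1 / 2 + pd.dual_weight / (2 * \<beta>) \<le> - 1" using coupling unfolding pd.dual_weight_def by linarith
    from mult_left_mono[OF this, of h] h_pos 1 show ?thesis by (simp add: algebra_simps)
  qed
  have cG: "((1 + pd.dual_weight * \<beta>) / (2 * h) + pd.dual_weight + 1 + \<beta>\<^sup>2 / 2) * (Lf\<^sup>2 * h\<^sup>2 / \<beta>\<^sup>2) - h / 2 + h\<^sup>2 * Lf / 2 \<le> 0"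
  proof -
    have e3: "(1 + pd.dual_weight * \<beta>) / (2 * h) * (Lf\<^sup>2 * h\<^sup>2 / \<beta>\<^sup>2) = h * (1 / 4 - eps3 \<alpha> \<beta> \<rho>2 Lf)"
      using h_pos \<beta>_pos pd.r2_pos unfolding eps3_def pd.dual_weight_def by (simp add: field_simps power2_eq_square)
    have "(pd.dual_weight + 1) / \<beta>\<^sup>2 * Lf\<^sup>2 \<le> 1 / \<beta>\<^sup>2 * (1 + 3 / (2 * \<rho>2) + 3 * \<alpha> / (2 * \<beta>)) * Lf\<^sup>2"
    proof -
      have "0 \<le> \<alpha> / \<beta>" "0 \<le> 1 / \<rho>2" using \<alpha>_gt \<beta>_pos pd.r2_pos by auto
      moreover have "3 / (2 * \<rho>2) = 3 / 2 * (1 / \<rho>2)" "3 * \<alpha> / (2 * \<beta>) = 3 / 2 * (\<alpha> / \<beta>)"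
        by simp_all
      ultimately have "pd.dual_weight + 1 \<le> 1 + 3 / (2 * \<rho>2) + 3 * \<alpha> / (2 * \<beta>)"
        unfolding pd.dual_weight_def by linarith
      from mult_right_mono[OF this, of "1 / \<beta>\<^sup>2 * Lf\<^sup>2"] show ?thesis by (simp add: mult_ac)
    qed
    then have "(pd.dual_weight + 1) / \<beta>\<^sup>2 * Lf\<^sup>2 + Lf\<^sup>2 / 2 + Lf / 2 \<le> eps4 \<alpha> \<beta> \<rho>2 Lf"
      unfolding eps4_def by (simp add: power2_eq_square ring_distribs add_divide_distrib)
    from mult_left_mono[OF this, of "h\<^sup>2"]
    have e4: "h\<^sup>2 * ((pd.dual_weight + 1) / \<beta>\<^sup>2 * Lf\<^sup>2 + Lf\<^sup>2 / 2 + Lf / 2) \<le> h * (h * eps4 \<alpha> \<beta> \<rho>2 Lf)"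
      by (simp add: power2_eq_square mult_ac)
    have e5: "h * (h * eps4 \<alpha> \<beta> \<rho>2 Lf) \<le> h * eps3 \<alpha> \<beta> \<rho>2 Lf"
      using h_eps4 h_pos by (intro mult_left_mono) auto
    have "(pd.dual_weight + 1 + \<beta>\<^sup>2 / 2) * (Lf\<^sup>2 * h\<^sup>2 / \<beta>\<^sup>2) = h\<^sup>2 * ((pd.dual_weight + 1) / \<beta>\<^sup>2 * Lf\<^sup>2 + Lf\<^sup>2 / 2)"
      using \<beta>_pos by (simp add: field_simps)
    then have "((1 + pd.dual_weight * \<beta>) / (2 * h) + pd.dual_weight + 1 + \<beta>\<^sup>2 / 2) * (Lf\<^sup>2 * h\<^sup>2 / \<beta>\<^sup>2)
        = h * (1 / 4 - eps3 \<alpha> \<beta> \<rho>2 Lf) + h\<^sup>2 * ((pd.dual_weight + 1) / \<beta>\<^sup>2 * Lf\<^sup>2 + Lf\<^sup>2 / 2)"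
      unfolding e3[symmetric] by (simp only: ring_distribs add.assoc)
    moreover have "h\<^sup>2 * ((pd.dual_weight + 1) / \<beta>\<^sup>2 * Lf\<^sup>2 + Lf\<^sup>2 / 2 + Lf / 2)
        = h\<^sup>2 * ((pd.dual_weight + 1) / \<beta>\<^sup>2 * Lf\<^sup>2 + Lf\<^sup>2 / 2) + h\<^sup>2 * Lf / 2"
      by (simp add: distrib_left)
    moreover have "h * (1 / 4 - eps3 \<alpha> \<beta> \<rho>2 Lf) = h / 4 - h * eps3 \<alpha> \<beta> \<rho>2 Lf"
      by (simp add: right_diff_distrib)
    ultimately show ?thesis using e4 e5 h_pos by linarith
  qed
  define wE where "wE = h * (- (\<alpha> - \<beta>) * \<rho>2 + 1 + Lf\<^sup>2)
        + h\<^sup>2 * (\<beta>\<^sup>2 * \<rho> + (\<alpha> * \<beta> + 2 * (\<alpha> - \<beta>)\<^sup>2 + \<alpha>\<^sup>2 / 2) * \<rho>\<^sup>2 + 5 / 2 * Lf\<^sup>2)"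
  define wU where "wU = h * (- \<beta> + 1 / 2 + pd.dual_weight / (2 * \<beta>)) + h\<^sup>2 * (\<beta>\<^sup>2 + 1 / 2)"
  define wD where "wD = (1 + pd.dual_weight * \<beta>) / (2 * h) + pd.dual_weight + 1 + \<beta>\<^sup>2 / 2"
  define c where "c = min (min 1 (1 - h * eps2 \<alpha> \<beta> \<rho> Lf)) (\<nu> / real CARD('n))"
  have c: "h * c \<le> h" "h * c \<le> h * (1 - h * eps2 \<alpha> \<beta> \<rho> Lf)" "h * c \<le> h * (\<nu> / real CARD('n))"
  proof -
    have "c \<le> 1" "c \<le> 1 - h * eps2 \<alpha> \<beta> \<rho> Lf" "c \<le> \<nu> / real CARD('n)"
      unfolding c_def by linarith+
    from this[THEN mult_left_mono, of h] h_pos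
    show "h * c \<le> h" "h * c \<le> h * (1 - h * eps2 \<alpha> \<beta> \<rho> Lf)" "h * c \<le> h * (\<nu> / real CARD('n))"
      by (simp_all del: times_divide_eq_right)
  qed
  have k: "h * c * E \<le> h * E" "h * c * U \<le> h * (1 - h * eps2 \<alpha> \<beta> \<rho> Lf) * U" "h * c * Q \<le> h * (\<nu> / real CARD('n)) * Q"
    using mult_right_mono[OF c(1) pos(1)] mult_right_mono[OF c(2) pos(2)] mult_right_mono[OF c(3) pos(4)]
    by auto
  have "lyap X' (next_dual X V) = pd.energy (centered X') (dual X' (next_dual X V)) + (F (mean X') - m)"
    by (simp add: lyap_def)
  also have "\<dots> \<le> pd.energy e u + Q - h * (\<nu> / real CARD('n)) * Q
      + (wE + h / 2 * Lf\<^sup>2) * E + wU * U + (wD * (Lf\<^sup>2 * h\<^sup>2 / \<beta>\<^sup>2) - h / 2 + h\<^sup>2 * Lf / 2) * G"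
    using W'[folded wE_def wU_def wD_def] F' by (simp add: algebra_simps)
  also have "\<dots> \<le> pd.energy e u + Q - h * (\<nu> / real CARD('n)) * Q + (- h) * E + (- (h * (1 - h * eps2 \<alpha> \<beta> \<rho> Lf))) * U + 0 * G"
    using mult_right_mono[OF cE[folded wE_def] pos(1)] mult_right_mono[OF cU[folded wU_def] pos(2)]
      mult_right_mono[OF cG[folded wD_def] pos(3)] by linarith
  also have "\<dots> \<le> pd.energy e u + Q - h * c * (E + U + Q)"
    using k by (simp only: distrib_left[of "h * c"] mult_minus_left mult_zero_left)
  finally show ?thesis by (simp only: X'_def lyap_def e_def u_def Q_def E_def U_def c_def)
qed

end

section \<open>The effect of the noise and the distance to the minimizers\<close>

context primal_dual
begin

text \<open>The noisy iterate is the noise-free one plus a perturbation \<open>p\<close> of the primal error and \<open>q\<close> of the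
  dual error. Since \<open>q\<close> contains the change of the gradients caused by the noise in the average, it is
  bounded by Lipschitz continuity.\<close>

lemma lyap_noise:
  assumes "0 < \<eta>"
  obtains C where "0 \<le> C" and "\<And>X V N Z.
    lyap (X - h *\<^sub>R (\<alpha> *\<^sub>R lap_op L (X + N) + \<beta> *\<^sub>R V + grad X + Z)) (V + (h * \<beta>) *\<^sub>R lap_op L (X + N))
    \<le> (1 + \<eta>) * lyap (next_primal X V) (next_dual X V) + C * ((norm N)\<^sup>2 + (norm Z)\<^sup>2)"
proof -
  define a where "a = 2 * h\<^sup>2 * \<alpha>\<^sup>2 * \<rho>\<^sup>2 + 2 * h\<^sup>2"
  define c where "c = 2 * h\<^sup>2 * \<beta>\<^sup>2 * \<rho>\<^sup>2 + 2 * (Lf\<^sup>2 * h\<^sup>2 / \<beta>\<^sup>2)"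
  define C where "C = (1 + 1 / \<eta>) * (a + (1 + pd.dual_weight) / 2 * c) + (Lf / (2 * \<eta>) + Lf / 2) * h\<^sup>2"
  have ac: "0 \<le> a" "0 \<le> c" by (auto simp: a_def c_def)
  then have "0 \<le> C" using assms pd.dual_weight_pos Lf_pos by (simp add: C_def)
  moreover have "lyap (X - h *\<^sub>R (\<alpha> *\<^sub>R lap_op L (X + N) + \<beta> *\<^sub>R V + grad X + Z)) (V + (h * \<beta>) *\<^sub>R lap_op L (X + N))
    \<le> (1 + \<eta>) * lyap (next_primal X V) (next_dual X V) + C * ((norm N)\<^sup>2 + (norm Z)\<^sup>2)"
    (is "lyap ?X ?V \<le> _") for X V N Z
  proof -
    define Y where "Y = ?X"
    define X' where "X' = next_primal X V"
    define V' where "V' = next_dual X V"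
    define B where "B = (norm N)\<^sup>2 + (norm Z)\<^sup>2"
    define w where "w = - (h *\<^sub>R (\<alpha> *\<^sub>R lap_op L N + Z))"
    define p where "p = centered w"
    define q where "q = (h * \<beta>) *\<^sub>R lap_op L N
      + (1 / \<beta>) *\<^sub>R centered (grad (replicated (mean Y)) - grad (replicated (mean X')))"
    have B: "0 \<le> B" "(norm N)\<^sup>2 \<le> B" "(norm Z)\<^sup>2 \<le> B" by (auto simp: B_def)
    have lapN: "(norm (lap_op L N))\<^sup>2 \<le> \<rho>\<^sup>2 * B"
    proof -
      have "(norm (lap_op L N))\<^sup>2 \<le> \<rho>\<^sup>2 * (norm N)\<^sup>2"
        using power_mono[OF norm_lap_op_le[of N], of 2] by (simp add: power_mult_distrib)
      also have "\<dots> \<le> \<rho>\<^sup>2 * B" using B by (intro mult_left_mono) auto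
      finally show ?thesis .
    qed
    have X: "Y = X' + w"
      by (simp add: Y_def X'_def next_primal_def w_def linear_simps scaleR_add_right algebra_simps)
    have V: "?V = V' + (h * \<beta>) *\<^sub>R lap_op L N"
      by (simp add: V'_def next_dual_def linear_simps scaleR_add_right)
    have mean_X: "mean Y = mean X' + (- (h *\<^sub>R mean Z))"
      by (simp add: X w_def linear_simps linear_neg[OF linear_mean])
    have cX: "centered Y = centered X' + p" by (simp add: X p_def linear_simps)
    have dV: "dual Y ?V = dual X' V' + q"
      unfolding V by (simp add: dual_def q_def linear_simps scaleR_diff_right algebra_simps)
    have p2: "(norm p)\<^sup>2 \<le> a * B"
    proof -
      have "(norm p)\<^sup>2 \<le> (norm w)\<^sup>2" unfolding p_def by (intro power_mono norm_centered_le) auto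
      also have "\<dots> = h\<^sup>2 * (norm (\<alpha> *\<^sub>R lap_op L N + Z))\<^sup>2" by (simp add: w_def power_mult_distrib)
      also have "\<dots> \<le> h\<^sup>2 * (2 * (\<alpha>\<^sup>2 * (norm (lap_op L N))\<^sup>2) + 2 * (norm Z)\<^sup>2)"
        using norm_add_sq_le[of "\<alpha> *\<^sub>R lap_op L N" Z] by (intro mult_left_mono) (auto simp: power_mult_distrib)
      also have "\<dots> \<le> h\<^sup>2 * (2 * (\<alpha>\<^sup>2 * (\<rho>\<^sup>2 * B)) + 2 * B)"
        using lapN B by (intro mult_left_mono add_mono) auto
      finally show ?thesis by (simp add: a_def algebra_simps)
    qed
    have mZ: "real CARD('n) * (norm (mean Y - mean X'))\<^sup>2 \<le> h\<^sup>2 * B"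
    proof -
      have "real CARD('n) * (norm (mean Y - mean X'))\<^sup>2 = h\<^sup>2 * (real CARD('n) * (norm (mean Z))\<^sup>2)"
        by (simp add: mean_X power_mult_distrib)
      also have "\<dots> \<le> h\<^sup>2 * B"
        using norm_mean_le[of Z] B by (intro mult_left_mono) auto
      finally show ?thesis .
    qed
    have q2: "(norm q)\<^sup>2 \<le> c * B"
    proof -
      have "(norm (centered (grad (replicated (mean Y)) - grad (replicated (mean X')))))\<^sup>2
          \<le> (norm (grad (replicated (mean Y)) - grad (replicated (mean X'))))\<^sup>2"
        by (intro power_mono norm_centered_le) auto
      also have "\<dots> \<le> Lf\<^sup>2 * (real CARD('n) * (norm (mean Y - mean X'))\<^sup>2)" by (rule grad_replicated_lipschitz_sq)
      also have "\<dots> \<le> Lf\<^sup>2 * (h\<^sup>2 * B)" using mZ by (intro mult_left_mono) auto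
      finally have g: "(norm (centered (grad (replicated (mean Y)) - grad (replicated (mean X')))))\<^sup>2 / \<beta>\<^sup>2
          \<le> Lf\<^sup>2 * (h\<^sup>2 * B) / \<beta>\<^sup>2" by (rule divide_right_mono) simp
      have "(norm q)\<^sup>2 \<le> 2 * (h\<^sup>2 * \<beta>\<^sup>2 * (norm (lap_op L N))\<^sup>2)
          + 2 * ((norm (centered (grad (replicated (mean Y)) - grad (replicated (mean X')))))\<^sup>2 / \<beta>\<^sup>2)"
        unfolding q_def using \<beta>_pos by (intro order_trans[OF norm_add_sq_le]) (simp add: power_mult_distrib power_divide)
      also have "\<dots> \<le> 2 * (h\<^sup>2 * \<beta>\<^sup>2 * (\<rho>\<^sup>2 * B)) + 2 * (Lf\<^sup>2 * (h\<^sup>2 * B) / \<beta>\<^sup>2)"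
        using lapN g by (intro mult_left_mono add_mono) auto
      finally show ?thesis by (simp add: c_def algebra_simps)
    qed
    have "pd.energy p q \<le> a * B + (1 + pd.dual_weight) / 2 * (c * B)"
      using p2 q2 pd.dual_weight_pos by (intro order_trans[OF pd.energy_upper] add_mono mult_left_mono) auto
    then have "(1 + 1 / \<eta>) * pd.energy p q \<le> (1 + 1 / \<eta>) * (a * B + (1 + pd.dual_weight) / 2 * (c * B))"
      using assms by (intro mult_left_mono) auto
    then have W: "pd.energy (centered Y) (dual Y ?V)
        \<le> (1 + \<eta>) * pd.energy (centered X') (dual X' V') + (1 + 1 / \<eta>) * (a + (1 + pd.dual_weight) / 2 * c) * B"
      using pd.energy_perturb[OF assms, of "centered X'" p "dual X' V'" q] unfolding cX dV
      by (simp add: algebra_simps)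
    have "F (mean Y) - m \<le> (1 + \<eta>) * (F (mean X') - m)
        + (real CARD('n) * Lf / (2 * \<eta>) + real CARD('n) * Lf / 2) * (norm (mean Y - mean X'))\<^sup>2"
      using F.increment_le[OF m_le assms, of "mean X'" "mean Y - mean X'"] by simp
    also have "(real CARD('n) * Lf / (2 * \<eta>) + real CARD('n) * Lf / 2) * (norm (mean Y - mean X'))\<^sup>2
        = (Lf / (2 * \<eta>) + Lf / 2) * (real CARD('n) * (norm (mean Y - mean X'))\<^sup>2)"
      by (simp add: algebra_simps)
    also have "\<dots> \<le> (Lf / (2 * \<eta>) + Lf / 2) * (h\<^sup>2 * B)"
      using mZ assms Lf_pos by (intro mult_left_mono) auto
    finally have "F (mean Y) - m \<le> (1 + \<eta>) * (F (mean X') - m) + (Lf / (2 * \<eta>) + Lf / 2) * (h\<^sup>2 * B)"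
      by simp
    with W show ?thesis
      unfolding Y_def[symmetric] lyap_def[of Y] lyap_def[of "next_primal X V"] X'_def V'_def B_def C_def
      by (simp add: distrib_right distrib_left mult.assoc)
  qed
  ultimately show ?thesis using that by blast
qed

lemma lyap_contraction:
  obtains d C where "0 < d" "d < 1" "0 \<le> C" and "\<And>X V N Z. mean V = 0 \<Longrightarrow>
    lyap (X - h *\<^sub>R (\<alpha> *\<^sub>R lap_op L (X + N) + \<beta> *\<^sub>R V + grad X + Z)) (V + (h * \<beta>) *\<^sub>R lap_op L (X + N))
    \<le> (1 - d) * lyap X V + C * ((norm N)\<^sup>2 + (norm Z)\<^sup>2)"
proof -
  define c where "c = min (min 1 (1 - h * eps2 \<alpha> \<beta> \<rho> Lf)) (\<nu> / real CARD('n))"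
  have "0 < c" using h_eps2 \<nu>_pos by (simp add: c_def)
  \<comment> \<open>the same \<open>g\<close> serves as noise-free contraction rate and as \<open>\<eta>\<close>, as \<open>(1 + g) (1 - g) < 1\<close>\<close>
  define g where "g = min (h * c / (1 + pd.dual_weight)) (1 / 2)"
  have g: "0 < g" "g < 1" "g \<le> h * c / (1 + pd.dual_weight)"
    using \<open>0 < c\<close> h_pos pd.dual_weight_pos by (auto simp: g_def)
  have next_le: "lyap (next_primal X V) (next_dual X V) \<le> (1 - g) * lyap X V" if "mean (V :: real ^ 'd ^ 'n) = 0" for X V
  proof -
    let ?S = "(norm (centered X))\<^sup>2 + (norm (dual X V))\<^sup>2 + (F (mean X) - m)"
    have "g * lyap X V \<le> h * c / (1 + pd.dual_weight) * lyap X V"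
      using g lyap_nonneg by (intro mult_right_mono) auto
    also have "\<dots> \<le> h * c / (1 + pd.dual_weight) * ((1 + pd.dual_weight) * ?S)"
      using lyap_upper h_pos \<open>0 < c\<close> pd.dual_weight_pos by (intro mult_left_mono) auto
    also have "\<dots> = h * c * ?S" using pd.dual_weight_pos by simp
    finally show ?thesis using lyap_next[OF that, of X] unfolding c_def[symmetric]
      by (simp add: left_diff_distrib)
  qed
  obtain C where C: "0 \<le> C" and noise: "\<And>X V N Z.
    lyap (X - h *\<^sub>R (\<alpha> *\<^sub>R lap_op L (X + N) + \<beta> *\<^sub>R V + grad X + Z)) (V + (h * \<beta>) *\<^sub>R lap_op L (X + N))
    \<le> (1 + g) * lyap (next_primal X V) (next_dual X V) + C * ((norm N)\<^sup>2 + (norm Z)\<^sup>2)"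
    using lyap_noise[OF g(1)] by blast
  show ?thesis
  proof (rule that[of "g\<^sup>2" C])
    show "0 < g\<^sup>2" "0 \<le> C" using g C by auto
    show "g\<^sup>2 < 1" using g by (simp add: power_less_one_iff)
    fix X V N Z :: "real ^ 'd ^ 'n" assume "mean V = 0"
    have "(1 + g) * lyap (next_primal X V) (next_dual X V) \<le> (1 + g) * ((1 - g) * lyap X V)"
      using next_le[OF \<open>mean V = 0\<close>] g by (intro mult_left_mono) auto
    also have "\<dots> = (1 - g\<^sup>2) * lyap X V" by (simp add: power2_eq_square algebra_simps)
    finally show "lyap (X - h *\<^sub>R (\<alpha> *\<^sub>R lap_op L (X + N) + \<beta> *\<^sub>R V + grad X + Z)) (V + (h * \<beta>) *\<^sub>R lap_op L (X + N))
      \<le> (1 - g\<^sup>2) * lyap X V + C * ((norm N)\<^sup>2 + (norm Z)\<^sup>2)"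
      using noise[of X N V Z] by linarith
  qed
qed

lemma closed_argmin_set: "closed (argmin_set F)"
proof -
  have "closed (F -` {m})" using F.continuous[of UNIV] by (intro closed_vimage) auto
  then show ?thesis by (simp add: argmin_set_eq vimage_def)
qed

text \<open>Go from \<open>X $ i\<close> to the average, which costs \<open>|e|\<close>, and from there to the nearest minimizer, which is no
  farther than the one provided by quadratic growth.\<close>

lemma distance_le_lyap:
  obtains C where "0 \<le> C" and
    "\<And>X V i. (norm (X $ i - closest_point (argmin_set F) (mean X)))\<^sup>2 \<le> C * lyap X V"
proof -
  have PL': "1 / 2 * (norm (gradient F y))\<^sup>2 \<ge> \<nu> * (F y - m)" for y by (rule PL)
  obtain K where K: "0 \<le> K" "\<And>y. \<exists>z. F z = m \<and> (norm (y - z))\<^sup>2 \<le> K * (F y - m)"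
    using F.PL_quadratic_growth[OF m_le \<nu>_pos PL'] by auto
  define k where "k = 1 / 2 * (1 - \<beta> / \<alpha>)"
  have "0 < k" using \<alpha>_gt \<beta>_pos by (simp add: k_def)
  have "(norm (X $ i - closest_point (argmin_set F) (mean X)))\<^sup>2 \<le> (2 / k + 2 * K) * lyap X V" for X V i
  proof -
    let ?c = "closest_point (argmin_set F) (mean X)"
    obtain z where z: "F z = m" "(norm (mean X - z))\<^sup>2 \<le> K * (F (mean X) - m)" using K(2) by blast
    have "dist (mean X) ?c \<le> dist (mean X) z"
      by (rule closest_point_le[OF closed_argmin_set]) (simp add: argmin_set_eq z)
    then have "(norm (mean X - ?c))\<^sup>2 \<le> (norm (mean X - z))\<^sup>2"
      by (intro power_mono) (auto simp: dist_norm)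
    also have "\<dots> \<le> K * (F (mean X) - m)" by (rule z)
    also have "\<dots> \<le> K * lyap X V"
      using pd.energy_nonneg[of "centered X" "dual X V"] K(1) by (intro mult_left_mono) (auto simp: lyap_def)
    finally have 1: "(norm (mean X - ?c))\<^sup>2 \<le> K * lyap X V" .
    have "k * (norm (centered X))\<^sup>2 \<le> lyap X V"
      using pd.energy_lower[of "centered X" "dual X V"] m_le[of "mean X"] by (simp add: lyap_def k_def)
    then have "(norm (centered X))\<^sup>2 \<le> 1 / k * lyap X V"
      using \<open>0 < k\<close> by (simp add: field_simps)
    moreover have "(norm (X $ i - mean X))\<^sup>2 \<le> (norm (centered X))\<^sup>2"
    proof -
      have "X $ i - mean X = centered X $ i" by (simp add: centered_def replicated_def)
      then show ?thesis by (simp add: power_mono Finite_Cartesian_Product.norm_nth_le)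
    qed
    ultimately have 2: "(norm (X $ i - mean X))\<^sup>2 \<le> 1 / k * lyap X V" by linarith
    have "(norm (X $ i - ?c))\<^sup>2 \<le> 2 * (norm (X $ i - mean X))\<^sup>2 + 2 * (norm (mean X - ?c))\<^sup>2"
      using norm_add_sq_le[of "X $ i - mean X" "mean X - ?c"] by simp
    with 1 2 show ?thesis by (simp add: algebra_simps)
  qed
  moreover have "0 \<le> 2 / k + 2 * K" using \<open>0 < k\<close> K by simp
  ultimately show ?thesis using that by blast
qed

lemma gap_le_lyap: "F (mean X) - m \<le> lyap X V"
  using pd.energy_nonneg by (simp add: lyap_def)

end

section \<open>Bounded moments\<close>

lemma second_moment_le:
  assumes "prob_space M" "subalgebra M G" "Z \<in> borel_measurable M"
    and "cond_second_moment_le M G Z s"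
  shows "(\<integral>\<^sup>+ \<omega>. ennreal ((norm (Z \<omega>))\<^sup>2) \<partial>M) \<le> ennreal s"
proof -
  interpret prob_space M by fact
  interpret finite_measure_subalgebra M G by unfold_locales (rule assms)
  have "(\<integral>\<^sup>+ \<omega>. ennreal ((norm (Z \<omega>))\<^sup>2) \<partial>M)
      = (\<integral>\<^sup>+ \<omega>. nn_cond_exp M G (\<lambda>\<omega>. ennreal ((norm (Z \<omega>))\<^sup>2)) \<omega> \<partial>M)"
    using nn_cond_exp_intg[of "\<lambda>_. 1" "\<lambda>\<omega>. ennreal ((norm (Z \<omega>))\<^sup>2)"] assms(3) by simp
  also have "\<dots> \<le> (\<integral>\<^sup>+ \<omega>. ennreal s \<partial>M)"
    using assms(4) unfolding cond_second_moment_le_def by (rule nn_integral_mono_AE)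
  also have "\<dots> = ennreal s" by (simp add: emeasure_space_1)
  finally show ?thesis .
qed

lemma second_moment_stacked_le:
  fixes Z :: "'n::finite \<Rightarrow> 'w \<Rightarrow> real ^ 'd::finite"
  assumes "prob_space M" "subalgebra M G" "\<And>i. Z i \<in> borel_measurable M"
    and "\<And>i. cond_second_moment_le M G (Z i) s" and "0 \<le> s"
  shows "(\<integral>\<^sup>+ \<omega>. ennreal ((norm (\<chi> i. Z i \<omega>))\<^sup>2) \<partial>M) \<le> ennreal (real CARD('n) * s)"
proof -
  have "(\<integral>\<^sup>+ \<omega>. ennreal ((norm (\<chi> i. Z i \<omega>))\<^sup>2) \<partial>M)
      = (\<integral>\<^sup>+ \<omega>. (\<Sum>i\<in>UNIV. ennreal ((norm (Z i \<omega>))\<^sup>2)) \<partial>M)"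
    by (simp add: norm_vec_sq[of "\<chi> i. Z i _"] sum_ennreal)
  also have "\<dots> = (\<Sum>i\<in>UNIV. \<integral>\<^sup>+ \<omega>. ennreal ((norm (Z i \<omega>))\<^sup>2) \<partial>M)"
    using assms(3) by (intro nn_integral_sum) auto
  also have "\<dots> \<le> (\<Sum>i\<in>(UNIV::'n set). ennreal s)"
    using assms by (intro sum_mono second_moment_le[of M G]) auto
  also have "\<dots> = ennreal (real CARD('n) * s)"
    using assms(5) by (simp add: ennreal_mult ennreal_of_nat_eq_real_of_nat)
  finally show ?thesis .
qed

lemma borel_measurable_vec_lambda:
  fixes Y :: "'n::finite \<Rightarrow> 'w \<Rightarrow> 'a::euclidean_space"
  assumes "\<And>i. Y i \<in> borel_measurable M"
  shows "(\<lambda>\<omega>. \<chi> i. Y i \<omega>) \<in> borel_measurable M"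
  unfolding borel_measurable_euclidean_space[of "\<lambda>\<omega>. \<chi> i. Y i \<omega>"]
proof
  fix b :: "'a ^ 'n"
  have "(\<lambda>\<omega>. (\<chi> i. Y i \<omega>) \<bullet> b) = (\<lambda>\<omega>. \<Sum>i\<in>UNIV. Y i \<omega> \<bullet> b $ i)"
    by (simp add: inner_vec_def)
  then show "(\<lambda>\<omega>. (\<chi> i. Y i \<omega>) \<bullet> b) \<in> borel_measurable M"
    using assms by simp
qed

text \<open>The map \<open>t \<mapsto> (1 - d) t + b\<close> does not increase \<open>y0 + b / d\<close>, which lies above its fixed point \<open>b / d\<close>.\<close>

lemma nn_integral_bounded_recursion:
  fixes Y R :: "nat \<Rightarrow> 'w \<Rightarrow> real"
  assumes "prob_space M"
    and meas: "\<And>k. Y k \<in> borel_measurable M" "\<And>k. R k \<in> borel_measurable M"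
    and nonneg: "\<And>k \<omega>. 0 \<le> Y k \<omega>" "\<And>k \<omega>. 0 \<le> R k \<omega>"
    and step: "\<And>k \<omega>. \<omega> \<in> space M \<Longrightarrow> Y (Suc k) \<omega> \<le> (1 - d) * Y k \<omega> + R k \<omega>"
    and init: "\<And>\<omega>. \<omega> \<in> space M \<Longrightarrow> Y 0 \<omega> \<le> y0"
    and R: "\<And>k. (\<integral>\<^sup>+ \<omega>. ennreal (R k \<omega>) \<partial>M) \<le> ennreal b"
    and "0 < d" "d < 1" "0 \<le> b" "0 \<le> y0"
  shows "(\<integral>\<^sup>+ \<omega>. ennreal (Y k \<omega>) \<partial>M) \<le> ennreal (y0 + b / d)"
proof (induction k)
  interpret prob_space M by fact
  case 0
  have "(\<integral>\<^sup>+ \<omega>. ennreal (Y 0 \<omega>) \<partial>M) \<le> (\<integral>\<^sup>+ \<omega>. ennreal y0 \<partial>M)"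
    using init by (intro nn_integral_mono ennreal_leI) auto
  also have "\<dots> = ennreal y0" by (simp add: emeasure_space_1)
  also have "\<dots> \<le> ennreal (y0 + b / d)" using \<open>0 < d\<close> \<open>0 \<le> b\<close> by (intro ennreal_leI) auto
  finally show ?case .
next
  case (Suc k)
  have "(\<integral>\<^sup>+ \<omega>. ennreal (Y (Suc k) \<omega>) \<partial>M)
      \<le> (\<integral>\<^sup>+ \<omega>. ennreal (1 - d) * ennreal (Y k \<omega>) + ennreal (R k \<omega>) \<partial>M)"
  proof (rule nn_integral_mono)
    fix \<omega> assume "\<omega> \<in> space M"
    from ennreal_leI[OF step[OF this]]
    show "ennreal (Y (Suc k) \<omega>) \<le> ennreal (1 - d) * ennreal (Y k \<omega>) + ennreal (R k \<omega>)"
      using nonneg \<open>d < 1\<close> by (simp add: ennreal_mult ennreal_plus)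
  qed
  also have "\<dots> = ennreal (1 - d) * (\<integral>\<^sup>+ \<omega>. ennreal (Y k \<omega>) \<partial>M) + (\<integral>\<^sup>+ \<omega>. ennreal (R k \<omega>) \<partial>M)"
    using meas by (simp add: nn_integral_add nn_integral_cmult)
  also have "\<dots> \<le> ennreal (1 - d) * ennreal (y0 + b / d) + ennreal b"
    using Suc.IH R by (intro add_mono mult_left_mono) auto
  also have "\<dots> = ennreal ((1 - d) * (y0 + b / d) + b)"
    using assms(9-) by (simp add: ennreal_mult ennreal_plus)
  also have "\<dots> \<le> ennreal (y0 + b / d)"
    using assms(9-) by (intro ennreal_leI) (simp add: field_simps)
  finally show ?case .
qed

context primal_dual
begin

lemma lyap_borel_measurable:
  assumes "X \<in> borel_measurable M" "V \<in> borel_measurable M"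
  shows "(\<lambda>\<omega>. lyap (X \<omega>) (V \<omega>)) \<in> borel_measurable M"
proof -
  have lin: "T \<in> borel_measurable borel" if "linear T" for T :: "'x::euclidean_space \<Rightarrow> 'y::euclidean_space"
    using that by (intro borel_measurable_continuous_onI linear_continuous_on)
      (simp add: linear_conv_bounded_linear[symmetric])
  have [measurable]: "(mean :: real ^ 'd ^ 'n \<Rightarrow> _) \<in> borel_measurable borel"
    "(centered :: real ^ 'd ^ 'n \<Rightarrow> _) \<in> borel_measurable borel"
    "(replicated :: _ \<Rightarrow> real ^ 'd ^ 'n) \<in> borel_measurable borel"
    "lap_pinv \<in> borel_measurable borel"
    using lin[OF linear_mean] lin[OF linear_centered] lin[OF linear_replicated] lin[OF pd.lin_P] by auto
  have "Lf-lipschitz_on UNIV grad"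
    using grad_lipschitz Lf_pos by (intro lipschitz_onI) (auto simp: dist_norm)
  then have [measurable]: "grad \<in> borel_measurable borel"
    by (intro borel_measurable_continuous_onI lipschitz_on_continuous_on)
  have [measurable]: "F \<in> borel_measurable borel"
    by (intro borel_measurable_continuous_onI F.continuous)
  note assms[measurable]
  show ?thesis unfolding lyap_def dual_def pd.energy_def by measurable
qed

text \<open>The dual iterates start at zero and the Laplacian produces vectors of mean zero, so the pathwise
  contraction applies at every step.\<close>

lemma lyap_expectation_bounded:
  fixes X V N Z :: "nat \<Rightarrow> 'w \<Rightarrow> real ^ 'd ^ 'n"
  assumes M: "prob_space M"
    and meas: "\<And>k. X k \<in> borel_measurable M" "\<And>k. V k \<in> borel_measurable M"
      "\<And>k. N k \<in> borel_measurable M" "\<And>k. Z k \<in> borel_measurable M"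
    and init: "\<And>\<omega>. \<omega> \<in> space M \<Longrightarrow> X 0 \<omega> = X0" "\<And>\<omega>. \<omega> \<in> space M \<Longrightarrow> V 0 \<omega> = 0"
    and X_step: "\<And>k \<omega>. \<omega> \<in> space M \<Longrightarrow> X (Suc k) \<omega> =
      X k \<omega> - h *\<^sub>R (\<alpha> *\<^sub>R lap_op L (X k \<omega> + N k \<omega>) + \<beta> *\<^sub>R V k \<omega> + grad (X k \<omega>) + Z k \<omega>)"
    and V_step: "\<And>k \<omega>. \<omega> \<in> space M \<Longrightarrow> V (Suc k) \<omega> = V k \<omega> + (h * \<beta>) *\<^sub>R lap_op L (X k \<omega> + N k \<omega>)"
    and N_bound: "\<And>k. (\<integral>\<^sup>+ \<omega>. ennreal ((norm (N k \<omega>))\<^sup>2) \<partial>M) \<le> ennreal bN"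
    and Z_bound: "\<And>k. (\<integral>\<^sup>+ \<omega>. ennreal ((norm (Z k \<omega>))\<^sup>2) \<partial>M) \<le> ennreal bZ"
    and b: "0 \<le> bN" "0 \<le> bZ"
  obtains B where "0 \<le> B" "\<And>k. (\<integral>\<^sup>+ \<omega>. ennreal (lyap (X k \<omega>) (V k \<omega>)) \<partial>M) \<le> ennreal B"
proof -
  obtain d C where dC: "0 < d" "d < 1" "0 \<le> C" and contr: "\<And>X V N Z. mean V = 0 \<Longrightarrow>
    lyap (X - h *\<^sub>R (\<alpha> *\<^sub>R lap_op L (X + N) + \<beta> *\<^sub>R V + grad X + Z)) (V + (h * \<beta>) *\<^sub>R lap_op L (X + N))
    \<le> (1 - d) * lyap X V + C * ((norm N)\<^sup>2 + (norm Z)\<^sup>2)"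
    using lyap_contraction by blast
  have mean_V: "mean (V k \<omega>) = 0" if "\<omega> \<in> space M" for k \<omega>
    by (induction k) (simp_all add: that init V_step linear_simps linear_0[OF linear_mean])
  have R: "(\<integral>\<^sup>+ \<omega>. ennreal (C * ((norm (N k \<omega>))\<^sup>2 + (norm (Z k \<omega>))\<^sup>2)) \<partial>M) \<le> ennreal (C * (bN + bZ))" for k
  proof -
    have "(\<integral>\<^sup>+ \<omega>. ennreal (C * ((norm (N k \<omega>))\<^sup>2 + (norm (Z k \<omega>))\<^sup>2)) \<partial>M)
        = (\<integral>\<^sup>+ \<omega>. ennreal C * (ennreal ((norm (N k \<omega>))\<^sup>2) + ennreal ((norm (Z k \<omega>))\<^sup>2)) \<partial>M)"
      using dC by (simp add: ennreal_mult ennreal_plus)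
    also have "\<dots> = ennreal C * ((\<integral>\<^sup>+ \<omega>. ennreal ((norm (N k \<omega>))\<^sup>2) \<partial>M) + (\<integral>\<^sup>+ \<omega>. ennreal ((norm (Z k \<omega>))\<^sup>2) \<partial>M))"
      using meas by (simp add: nn_integral_add nn_integral_cmult)
    also have "\<dots> \<le> ennreal C * (ennreal bN + ennreal bZ)"
      by (intro mult_left_mono add_mono N_bound Z_bound) auto
    also have "\<dots> = ennreal (C * (bN + bZ))" using dC b by (simp add: ennreal_mult ennreal_plus)
    finally show ?thesis .
  qed
  have "(\<integral>\<^sup>+ \<omega>. ennreal (lyap (X k \<omega>) (V k \<omega>)) \<partial>M) \<le> ennreal (lyap X0 0 + C * (bN + bZ) / d)" for k
  proof (rule nn_integral_bounded_recursion[OF M, where Y = "\<lambda>k \<omega>. lyap (X k \<omega>) (V k \<omega>)"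
      and R = "\<lambda>k \<omega>. C * ((norm (N k \<omega>))\<^sup>2 + (norm (Z k \<omega>))\<^sup>2)"])
    show "(\<lambda>\<omega>. lyap (X k \<omega>) (V k \<omega>)) \<in> borel_measurable M" for k
      by (intro lyap_borel_measurable meas)
    show "(\<lambda>\<omega>. C * ((norm (N k \<omega>))\<^sup>2 + (norm (Z k \<omega>))\<^sup>2)) \<in> borel_measurable M" for k
      using meas by measurable
    show "lyap (X (Suc k) \<omega>) (V (Suc k) \<omega>)
        \<le> (1 - d) * lyap (X k \<omega>) (V k \<omega>) + C * ((norm (N k \<omega>))\<^sup>2 + (norm (Z k \<omega>))\<^sup>2)"
      if "\<omega> \<in> space M" for k \<omega>
      unfolding X_step[OF that] V_step[OF that] by (rule contr[OF mean_V[OF that]])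
  qed (use dC b R lyap_nonneg init in auto)
  moreover have "0 \<le> lyap X0 0 + C * (bN + bZ) / d" using lyap_nonneg dC b by simp
  ultimately show ?thesis using that by blast
qed

end

theorem theorem3:
  fixes A :: "real ^ 'n::finite ^ 'n"
    and f :: "'n \<Rightarrow> real ^ 'd::finite \<Rightarrow> real"
    and F :: "real ^ 'd \<Rightarrow> real"
    and Lfi :: "'n \<Rightarrow> real"
    and Lf \<nu> \<sigma> :: real
    and l u :: real and b :: nat
    and \<alpha> \<beta> h \<kappa>\<^sub>2 :: real
    and L :: "real ^ 'n ^ 'n" and \<rho> \<rho>\<^sub>2 :: real
    and M :: "'w measure" and Filt :: "nat \<Rightarrow> 'w measure"
    and x0 :: "'n \<Rightarrow> real ^ 'd"
    and x v q g \<zeta> :: "nat \<Rightarrow> 'n \<Rightarrow> 'w \<Rightarrow> real ^ 'd"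
  \<comment> \<open>objective function\<close>
  assumes F_eq: "F = (\<lambda>y. \<Sum>i\<in>UNIV. f i y)"
    and argmin_nonempty: "argmin_set F \<noteq> {}"
    and argmin_convex: "convex (argmin_set F)"
    and f_C1: "\<And>i. continuously_differentiable (f i)"
    and Lfi_pos: "\<And>i. Lfi i > 0"
    and f_smooth: "\<And>i y z. norm (gradient (f i) y - gradient (f i) z) \<le> Lfi i * norm (y - z)"
    and Lf_eq: "Lf = Max (range Lfi)"
    and \<nu>_pos: "\<nu> > 0"
    and PL: "\<And>y. 1 / 2 * (norm (gradient F y))\<^sup>2 \<ge> \<nu> * (F y - min_value F)"
  \<comment> \<open>network\<close>
    and two_agents: "CARD('n) \<ge> 2"
    and adjacency: "weighted_adjacency A"
    and connected: "connected_graph A"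
    and L_eq: "L = laplacian A"
    and \<rho>_eq: "\<rho> = spectral_radius L"
    and \<rho>\<^sub>2_eq: "\<rho>\<^sub>2 = min_nonzero_eigenvalue L"
  \<comment> \<open>probability space and filtration\<close>
    and prob: "prob_space M"
    and filt: "filtration (space M) Filt"
    and filt_sub: "\<And>k. subalgebra M (Filt k)"
    and x_meas: "\<And>k i. x k i \<in> borel_measurable (Filt k)"
    and v_meas: "\<And>k i. v k i \<in> borel_measurable (Filt k)"
    and q_meas: "\<And>k i. q k i \<in> borel_measurable (Filt (Suc k))"
    and \<zeta>_meas: "\<And>k i. \<zeta> k i \<in> borel_measurable (Filt (Suc k))"
  \<comment> \<open>quantizer\<close>
    and range: "l < u" and bits: "b \<ge> 1"
    and quantizer: "\<And>k i. random_quantization M (Filt k) l u b (x k i) (q k i)"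
    and quant_mean: "\<And>k i. cond_mean_zero M (Filt k) (\<lambda>\<omega>. q k i \<omega> - x k i \<omega>)"
    and quant_var: "\<And>k i. cond_second_moment_le M (Filt k) (\<lambda>\<omega>. q k i \<omega> - x k i \<omega>)
                       (real CARD('d) * (quant_step l u b)\<^sup>2 / 4)"
  \<comment> \<open>stochastic gradients\<close>
    and g_eq: "\<And>k i \<omega>. \<omega> \<in> space M \<Longrightarrow> g k i \<omega> = gradient (f i) (x k i \<omega>) + \<zeta> k i \<omega>"
    and \<zeta>_mean: "\<And>k i. cond_mean_zero M (Filt k) (\<zeta> k i)"
    and \<zeta>_var: "\<And>k i. cond_second_moment_le M (Filt k) (\<zeta> k i) (\<sigma>\<^sup>2)"
  \<comment> \<open>algorithm and parameters\<close>
    and algorithm: "q_pdgd M L \<alpha> \<beta> h x0 q g x v"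
    and \<alpha>_pos: "\<alpha> > 0" and \<beta>_pos: "\<beta> > 0"
    and \<kappa>\<^sub>2_gt_1: "\<kappa>\<^sub>2 > 1"
    and \<alpha>_lower: "\<beta> + kappa1 \<rho>\<^sub>2 Lf \<le> \<alpha>"
    and \<alpha>_upper: "\<alpha> \<le> \<kappa>\<^sub>2 * \<beta>"
    and \<beta>_lower: "\<beta> \<ge> Max {kappa3 \<kappa>\<^sub>2 \<rho>\<^sub>2 Lf, kappa4 \<kappa>\<^sub>2 \<rho>\<^sub>2, kappa5 \<kappa>\<^sub>2 \<rho>\<^sub>2 Lf}"
    and h_pos: "0 < h"
    and h_upper: "h < min (eps1 CARD('n) \<nu> \<alpha> \<beta> \<rho> \<rho>\<^sub>2 Lf / eps2 \<alpha> \<beta> \<rho> Lf)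
                          (eps3 \<alpha> \<beta> \<rho>\<^sub>2 Lf / eps4 \<alpha> \<beta> \<rho>\<^sub>2 Lf)"
  shows "\<exists>C_err > 0. \<forall>i.
    limsup (\<lambda>k.
      (\<integral>\<^sup>+ \<omega>. ennreal ((norm (x k i \<omega> -
           closest_point (argmin_set F) (agent_mean (\<lambda>j. x k j \<omega>))))\<^sup>2) \<partial>M) +
      (\<integral>\<^sup>+ \<omega>. ennreal (F (agent_mean (\<lambda>j. x k j \<omega>)) - min_value F) \<partial>M))
    \<le> ennreal C_err"
proof -
  have graph: "graph_laplacian A L"
    using adjacency connected two_agents L_eq by unfold_locales
  then have \<rho>\<^sub>2_pos: "0 < \<rho>\<^sub>2" unfolding \<rho>\<^sub>2_eq by (rule graph_laplacian.spectral_gap(1))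
  have Lfi_le: "Lfi i \<le> Lf" for i unfolding Lf_eq by (rule Max_ge) auto
  have Lf_pos: "0 < Lf" using Lfi_pos[of undefined] Lfi_le[of undefined] by linarith
  have f_lip: "norm (gradient (f i) y - gradient (f i) z) \<le> Lf * norm (y - z)" for i y z
    using f_smooth[of i y z] mult_right_mono[OF Lfi_le[of i], of "norm (y - z)"] by simp
  \<comment> \<open>\<open>\<kappa>\<^sub>1\<close> is chosen for this\<close>
  have gain: "4 + 3 / 2 * Lf\<^sup>2 \<le> (\<alpha> - \<beta>) * \<rho>\<^sub>2"
  proof -
    have "(4 + 3 / 2 * Lf\<^sup>2) / \<rho>\<^sub>2 \<le> \<alpha> - \<beta>" using \<alpha>_lower by (simp add: kappa1_def)
    then show ?thesis using \<rho>\<^sub>2_pos by (simp add: pos_divide_le_eq)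
  qed
  \<comment> \<open>\<open>\<kappa>\<^sub>4\<close> is the larger root of \<open>2 t\<^sup>2 - 3 t - (\<kappa>\<^sub>2 + 1 / \<rho>\<^sub>2)\<close>, and \<open>\<alpha> / \<beta> \<le> \<kappa>\<^sub>2\<close>\<close>
  have coupling: "1 \<le> \<beta> - 1 / 2 - (1 / \<rho>\<^sub>2 + \<alpha> / \<beta>) / (2 * \<beta>)"
  proof -
    let ?w = "9 + 8 * \<kappa>\<^sub>2 + 8 / \<rho>\<^sub>2"
    have "sqrt ?w \<le> 4 * \<beta> - 3" using \<beta>_lower by (simp add: kappa4_def)
    moreover have "0 \<le> ?w" using \<kappa>\<^sub>2_gt_1 \<rho>\<^sub>2_pos by simp
    ultimately have "?w \<le> (4 * \<beta> - 3)\<^sup>2"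
      using power_mono[of "sqrt ?w" "4 * \<beta> - 3" 2] by simp
    then have "\<kappa>\<^sub>2 + 1 / \<rho>\<^sub>2 \<le> 2 * \<beta>\<^sup>2 - 3 * \<beta>"
      by (simp add: power2_eq_square algebra_simps)
    moreover have "\<alpha> / \<beta> \<le> \<kappa>\<^sub>2" using \<alpha>_upper \<beta>_pos by (simp add: pos_divide_le_eq)
    ultimately have "1 / \<rho>\<^sub>2 + \<alpha> / \<beta> \<le> (\<beta> - 3 / 2) * (2 * \<beta>)"
      by (simp add: power2_eq_square algebra_simps)
    then have "(1 / \<rho>\<^sub>2 + \<alpha> / \<beta>) / (2 * \<beta>) \<le> \<beta> - 3 / 2"
      using \<beta>_pos by (subst pos_divide_le_eq) auto
    then show ?thesis by linarith
  qed
  have h_eps2: "h * eps2 \<alpha> \<beta> \<rho> Lf < 1"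
  proof -
    have "0 < 2 * \<beta>\<^sup>2 + 1 / 2" by (rule add_nonneg_pos) auto
    then have "0 < eps2 \<alpha> \<beta> \<rho> Lf" unfolding eps2_def by (simp add: less_max_iff_disj)
    then have "h * eps2 \<alpha> \<beta> \<rho> Lf < eps1 CARD('n) \<nu> \<alpha> \<beta> \<rho> \<rho>\<^sub>2 Lf"
      using h_upper by (simp add: pos_less_divide_eq)
    also have "\<dots> \<le> 1" unfolding eps1_def by (rule Min_le) auto
    finally show ?thesis .
  qed
  have h_eps4: "h * eps4 \<alpha> \<beta> \<rho>\<^sub>2 Lf < eps3 \<alpha> \<beta> \<rho>\<^sub>2 Lf"
  proof -
    have "0 < eps4 \<alpha> \<beta> \<rho>\<^sub>2 Lf"
      unfolding eps4_def using \<alpha>_pos \<beta>_pos \<rho>\<^sub>2_pos Lf_pos by (intro add_nonneg_pos) auto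
    then show ?thesis using h_upper by (simp add: pos_less_divide_eq)
  qed
  interpret primal_dual A L f F Lf \<nu> \<alpha> \<beta> h
    using graph F_eq argmin_nonempty f_C1 f_lip Lf_pos \<nu>_pos PL \<beta>_pos h_pos gain coupling h_eps2 h_eps4
    unfolding \<rho>_eq \<rho>\<^sub>2_eq
    by (intro primal_dual.intro primal_dual_axioms.intro) (auto simp: continuously_differentiable_def)
  define X where "X k \<omega> = (\<chi> i. x k i \<omega>)" for k \<omega>
  define V where "V k \<omega> = (\<chi> i. v k i \<omega>)" for k \<omega>
  define N where "N k \<omega> = (\<chi> i. q k i \<omega> - x k i \<omega>)" for k \<omega>
  define Z where "Z k \<omega> = (\<chi> i. \<zeta> k i \<omega>)" for k \<omega>
  note to_M = measurable_from_subalg[OF filt_sub]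
  have meas: "x k i \<in> borel_measurable M" "v k i \<in> borel_measurable M"
    "q k i \<in> borel_measurable M" "\<zeta> k i \<in> borel_measurable M" for k i
    using to_M x_meas v_meas q_meas \<zeta>_meas by blast+
  have alg: "x 0 i \<omega> = x0 i" "v 0 i \<omega> = 0"
    "x (Suc k) i \<omega> = x k i \<omega> - h *\<^sub>R (\<alpha> *\<^sub>R (\<Sum>j\<in>UNIV. L $ i $ j *\<^sub>R q k j \<omega>) + \<beta> *\<^sub>R v k i \<omega> + g k i \<omega>)"
    "v (Suc k) i \<omega> = v k i \<omega> + (h * \<beta>) *\<^sub>R (\<Sum>j\<in>UNIV. L $ i $ j *\<^sub>R q k j \<omega>)"
    if "\<omega> \<in> space M" for k i \<omega>
    using algorithm that unfolding q_pdgd_def by blast+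
  have XN: "X k \<omega> + N k \<omega> = (\<chi> i. q k i \<omega>)" for k \<omega>
    by (simp add: X_def N_def vec_eq_iff)
  obtain B where B: "0 \<le> B" "\<And>k. (\<integral>\<^sup>+ \<omega>. ennreal (lyap (X k \<omega>) (V k \<omega>)) \<partial>M) \<le> ennreal B"
  proof (rule lyap_expectation_bounded[OF prob, of X V N Z "\<chi> i. x0 i"
        "real CARD('n) * (real CARD('d) * (quant_step l u b)\<^sup>2 / 4)" "real CARD('n) * \<sigma>\<^sup>2"])
    show "X k \<in> borel_measurable M" "V k \<in> borel_measurable M"
      "N k \<in> borel_measurable M" "Z k \<in> borel_measurable M" for k
      unfolding X_def[abs_def] V_def[abs_def] N_def[abs_def] Z_def[abs_def]
      using meas by (auto intro!: borel_measurable_vec_lambda borel_measurable_diff)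
    show "X 0 \<omega> = (\<chi> i. x0 i)" "V 0 \<omega> = 0" if "\<omega> \<in> space M" for \<omega>
      by (simp_all add: X_def V_def alg that vec_eq_iff)
    show "X (Suc k) \<omega> = X k \<omega> - h *\<^sub>R (\<alpha> *\<^sub>R lap_op L (X k \<omega> + N k \<omega>) + \<beta> *\<^sub>R V k \<omega> + grad (X k \<omega>) + Z k \<omega>)"
      "V (Suc k) \<omega> = V k \<omega> + (h * \<beta>) *\<^sub>R lap_op L (X k \<omega> + N k \<omega>)" if "\<omega> \<in> space M" for k \<omega>
      unfolding XN by (simp_all add: X_def V_def Z_def alg that g_eq lap_op_def grad_def vec_eq_iff add.assoc)
    show "(\<integral>\<^sup>+ \<omega>. ennreal ((norm (N k \<omega>))\<^sup>2) \<partial>M)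
        \<le> ennreal (real CARD('n) * (real CARD('d) * (quant_step l u b)\<^sup>2 / 4))" for k
      unfolding N_def using meas quant_var
      by (intro second_moment_stacked_le[OF prob filt_sub[of k]] borel_measurable_diff) auto
    show "(\<integral>\<^sup>+ \<omega>. ennreal ((norm (Z k \<omega>))\<^sup>2) \<partial>M) \<le> ennreal (real CARD('n) * \<sigma>\<^sup>2)" for k
      unfolding Z_def using meas \<zeta>_var
      by (intro second_moment_stacked_le[OF prob filt_sub[of k]]) auto
  qed auto
  obtain C where C: "0 \<le> C" and dist:
    "\<And>X V i. (norm (X $ i - closest_point (argmin_set F) (mean X)))\<^sup>2 \<le> C * lyap X V"
    using distance_le_lyap by blast
  have mean_X: "mean (X k \<omega>) = agent_mean (\<lambda>j. x k j \<omega>)" for k \<omega>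
    by (simp add: mean_def X_def agent_mean_def)
  have meas_lyap: "(\<lambda>\<omega>. lyap (X k \<omega>) (V k \<omega>)) \<in> borel_measurable M" for k
    unfolding X_def V_def using meas by (intro lyap_borel_measurable borel_measurable_vec_lambda)
  have bound: "(\<integral>\<^sup>+ \<omega>. ennreal ((norm (x k i \<omega> -
           closest_point (argmin_set F) (agent_mean (\<lambda>j. x k j \<omega>))))\<^sup>2) \<partial>M) +
      (\<integral>\<^sup>+ \<omega>. ennreal (F (agent_mean (\<lambda>j. x k j \<omega>)) - min_value F) \<partial>M)
      \<le> ennreal (C * B + B + 1)" (is "?I1 + ?I2 \<le> _") for k i
  proof -
    have "?I1 \<le> (\<integral>\<^sup>+ \<omega>. ennreal C * ennreal (lyap (X k \<omega>) (V k \<omega>)) \<partial>M)"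
    proof (rule nn_integral_mono)
      fix \<omega>
      have "(norm (x k i \<omega> - closest_point (argmin_set F) (agent_mean (\<lambda>j. x k j \<omega>))))\<^sup>2
          \<le> C * lyap (X k \<omega>) (V k \<omega>)"
        using dist[of "X k \<omega>" i "V k \<omega>"] unfolding mean_X by (simp add: X_def)
      then show "ennreal ((norm (x k i \<omega> - closest_point (argmin_set F) (agent_mean (\<lambda>j. x k j \<omega>))))\<^sup>2)
          \<le> ennreal C * ennreal (lyap (X k \<omega>) (V k \<omega>))"
        using C lyap_nonneg by (simp add: ennreal_mult[symmetric] ennreal_leI)
    qed
    also have "\<dots> = ennreal C * (\<integral>\<^sup>+ \<omega>. ennreal (lyap (X k \<omega>) (V k \<omega>)) \<partial>M)"
      using meas_lyap by (intro nn_integral_cmult) auto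
    also have "\<dots> \<le> ennreal C * ennreal B" by (intro mult_left_mono B) auto
    finally have 1: "?I1 \<le> ennreal (C * B)" using C B by (simp add: ennreal_mult)
    have "?I2 \<le> (\<integral>\<^sup>+ \<omega>. ennreal (lyap (X k \<omega>) (V k \<omega>)) \<partial>M)"
      unfolding mean_X[symmetric] by (intro nn_integral_mono ennreal_leI gap_le_lyap)
    also have "\<dots> \<le> ennreal B" by (rule B)
    finally have "?I1 + ?I2 \<le> ennreal (C * B) + ennreal B" using 1 by (intro add_mono)
    also have "\<dots> \<le> ennreal (C * B + B + 1)"
      using B C by (simp add: ennreal_plus[symmetric] ennreal_leI del: ennreal_plus)
    finally show ?thesis .
  qed
  show ?thesis
  proof (intro exI[of _ "C * B + B + 1"] conjI allI)
    show "0 < C * B + B + 1" using B C by (simp add: add_nonneg_pos)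
  qed (intro Limsup_bounded always_eventually allI bound)
qed

end
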